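(* Consider the special model $\mathrm{BOHT}(2,r,\lambda,D)$ with $\lambda\in[0,1]$ and $D$ a distribution on $\mathbb{Z}_{\ge0}$ with mean $d$. (i) If $r\in\{3,4\}$ and $(r-1)d\lambda^2\le 1$, reconstruction is impossible. (ii) If $r\ge 5$ and $(r-1)\,d\,\sup_{0<\epsilon\le 1}f_{r,\lambda}(\epsilon)<1$, where $f_{r,\lambda}(\epsilon):=\frac{1}{r-1}\sum_{i=1}^{r-1}\binom{r-1}{i}(1-\epsilon)^{r-1-i}\epsilon^{i-1}\frac{\lambda^2}{\lambda+(1-\lambda)2^{1-i}}$, then reconstruction is impossible. (iii) If $r\ge 5$, $\lambda\ge\frac15$ and $(r-1)d\lambda^2\le 1$, reconstruction is impossible.
   Context: For integer $r\ge2$ and $\lambda\in[0,1]$, $B_{r,\lambda}:\{\pm\}\to\{\pm\}^{r-1}$ is the kernel $B_{r,\lambda}(x_1,\dots,x_{r-1}|y)=\lambda+2^{-(r-1)}(1-\lambda)$ if $x_i=y$ for all $i$, and $2^{-(r-1)}(1-\lambda)$ otherwise. The special model $\mathrm{BOHT}(2,r,\lambda,D)$ is the broadcasting model on a Galton–Watson $r$-uniform linear hypertree rooted at $\rho$ in which each vertex independently has $t\sim D$ downward hyperedges (each consisting of the vertex and $r-1$ new children); $\sigma_\rho\sim\mathrm{Unif}(\{\pm\})$, and given $\sigma_u$, the labels of the $r-1$ children in each downward hyperedge of $u$ are drawn independently across hyperedges from $B_{r,\lambda}(\cdot|\sigma_u)$. With $T_k$ the set of vertices at distance $\le k$ from $\rho$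 and $L_k$ those at distance exactly $k$, reconstruction is impossible if $\lim_{k\to\infty}I(\sigma_\rho;T_k,\sigma_{L_k})=0$. *)

theory Defs
  imports "HOL-Probability.Probability"
begin

text \<open>Spins: True = +, False = -.\<close>

text \<open>Observed part (T_k, sigma_{L_k}) of the hypertree: a plane tree whose internal vertices
  (depth < k) carry the list of their downward hyperedges (each a list of the r-1 children),
  and whose vertices at depth k are leaves carrying their (observed) label.  Labels of
  vertices at depth < k are not observed.\<close>
datatype otree = Leaf bool | Node "otree list list"


primrec list_pmf :: "'a pmf list \<Rightarrow> 'a list pmf" where
  "list_pmf [] = return_pmf []"
| "list_pmf (p # ps) = do {x \<leftarrow> p; xs \<leftarrow> list_pmf ps; return_pmf (x # xs)}"

definition B_kernel :: "nat \<Rightarrow> real \<Rightarrow> bool \<Rightarrow> bool list pmf" where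
  "B_kernel r lam y = embed_pmf (\<lambda>xs. if length xs = r - 1 then
       (if (\<forall>x\<in>set xs. x = y) then lam + (1 - lam) / 2 ^ (r - 1) else (1 - lam) / 2 ^ (r - 1))
     else 0)"

fun obs_pmf :: "nat pmf \<Rightarrow> nat \<Rightarrow> real \<Rightarrow> nat \<Rightarrow> bool \<Rightarrow> otree pmf" where
  "obs_pmf D r lam 0 s = return_pmf (Leaf s)"
| "obs_pmf D r lam (Suc k) s =
     do { t \<leftarrow> D;
          hs \<leftarrow> replicate_pmf t (do { xs \<leftarrow> B_kernel r lam s; list_pmf (map (obs_pmf D r lam k) xs) });
          return_pmf (Node hs) }"

definition BOHT_joint :: "nat pmf \<Rightarrow> nat \<Rightarrow> real \<Rightarrow> nat \<Rightarrow> (bool \<times> otree) pmf" where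
  "BOHT_joint D r lam k = do { s \<leftarrow> pmf_of_set (UNIV :: bool set);
                             t \<leftarrow> obs_pmf D r lam k s; return_pmf (s, t) }"

definition BOHT_MI :: "nat pmf \<Rightarrow> nat \<Rightarrow> real \<Rightarrow> nat \<Rightarrow> real" where
  "BOHT_MI D r lam k = prob_space.mutual_information (measure_pmf (BOHT_joint D r lam k)) (exp 1)
      (count_space UNIV) (count_space UNIV) fst snd"

definition reconstruction_impossible :: "nat pmf \<Rightarrow> nat \<Rightarrow> real \<Rightarrow> bool" where
  "reconstruction_impossible D r lam \<longleftrightarrow> (BOHT_MI D r lam \<longlonglongrightarrow> 0)"

definition f_rl :: "nat \<Rightarrow> real \<Rightarrow> real \<Rightarrow> real" where
  "f_rl r lam eps = 1 / (real r - 1) * (\<Sum>i=1..r-1. real ((r - 1) choose i) * (1 - eps) ^ (r - 1 - i)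
      * eps ^ (i - 1) * (lam\<^sup>2 / (lam + (1 - lam) * 2 powr (1 - real i))))"

end

theory Submission
  imports Defs
begin

text \<open>
  Let \<open>x\<^sub>k\<close> be the chi-square information \<open>E \<theta>\<^sup>2\<close> that the depth-\<open>k\<close> observation carries about the root, where \<open>\<theta>\<close>
  is the posterior bias of the root spin; it dominates the mutual information. For symmetric channels it is
  subadditive over conditionally independent observations, so \<open>x\<^sub>k\<^sub>+\<^sub>1\<close> is at most \<open>d\<close> times the information
  passing through a single hyperedge. The chi-square information through a hyperedge does not decrease if each child
  observation is replaced by an erasure channel revealing the child with probability \<open>x\<^sub>k\<close>; this gives
  \<open>x\<^sub>k\<^sub>+\<^sub>1 \<le> (r - 1) d x\<^sub>k f(x\<^sub>k)\<close>, where \<open>f\<close> is the function of part (ii), and \<open>f(\<epsilon>) < \<lambda>\<^sup>2\<close> for \<open>\<epsilon> > 0\<close> whenever \<open>r = 3\<close>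
  and \<open>\<lambda> > 0\<close>, or \<open>\<lambda> \<ge> 1/5\<close>. For \<open>r = 4\<close> and small \<open>\<lambda>\<close> this fails, and \<open>\<theta>\<^sup>2\<close> is replaced by \<open>\<theta>\<^sup>2 + \<theta>\<^sup>4 / 3\<close>, a truncation of
  \<open>\<theta> artanh \<theta>\<close> (the symmetric Kullback-Leibler information). It is still subadditive, but is bounded, and its value through a
  hyperedge, divided by \<open>\<lambda>\<^sup>2\<close>, is convex in \<open>\<lambda>\<close>, so that only \<open>\<lambda> = 0\<close> and \<open>\<lambda> = 1\<close> matter.
\<close>

section \<open>Capacities of binary-input channels\<close>

instance otree :: countable by countable_datatype

text \<open>Each \<open>F\<close> used below is homogeneous of degree one, so \<open>cap F P\<close> can be computed from densities with
  respect to any common base measure.\<close>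

definition cap :: "(real \<Rightarrow> real \<Rightarrow> real) \<Rightarrow> (bool \<Rightarrow> 'a pmf) \<Rightarrow> real" where
  "cap F P = (\<integral>y. F (pmf (P True) y) (pmf (P False) y) \<partial>count_space UNIV)"

definition spin :: "bool \<Rightarrow> real" where
  "spin s = (if s then 1 else -1)"

definition mix :: "(bool \<Rightarrow> 'a pmf) \<Rightarrow> 'a pmf" where
  "mix P = bind_pmf (pmf_of_set UNIV) P"

text \<open>The posterior mean of the spin under the uniform prior. Where both likelihoods vanish,
  division by zero gives 0, so that \<open>abs_bias_le\<close> and \<open>pmf_bias\<close> hold at
  every \<open>y\<close>.\<close>

definition bias :: "(bool \<Rightarrow> 'a pmf) \<Rightarrow> 'a \<Rightarrow> real" where
  "bias P y = (pmf (P True) y - pmf (P False) y) / (pmf (P True) y + pmf (P False) y)"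

definition law :: "(bool \<Rightarrow> 'a pmf) \<Rightarrow> real pmf" where
  "law P = map_pmf (bias P) (mix P)"

text \<open>Symmetry is stated through the law of the posterior bias, which avoids carrying an
  involution on the outputs.\<close>

definition symmetric_channel :: "(bool \<Rightarrow> 'a pmf) \<Rightarrow> bool" where
  "symmetric_channel P \<longleftrightarrow> map_pmf uminus (law P) = law P"

section \<open>Expectations of bounded functions under a pmf\<close>

lemma integrable_pmf_bounded:
  fixes f :: "'a \<Rightarrow> real"
  assumes "\<And>x. x \<in> set_pmf p \<Longrightarrow> \<bar>f x\<bar> \<le> B"
  shows "integrable (measure_pmf p) f"
  by (rule measure_pmf.integrable_const_bound[where B=B]) (auto intro!: AE_pmfI assms)

lemma expectation_mono_pmf:
  fixes f g :: "'a \<Rightarrow> real"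
  assumes "\<And>x. x \<in> set_pmf p \<Longrightarrow> f x \<le> g x"
    and "\<And>x. x \<in> set_pmf p \<Longrightarrow> \<bar>f x\<bar> \<le> B"
    and "\<And>x. x \<in> set_pmf p \<Longrightarrow> \<bar>g x\<bar> \<le> C"
  shows "measure_pmf.expectation p f \<le> measure_pmf.expectation p g"
  by (rule integral_mono_AE)
     (auto intro!: AE_pmfI integrable_pmf_bounded[of p f B] integrable_pmf_bounded[of p g C] assms)

lemma expectation_cong_pmf:
  fixes f g :: "'a \<Rightarrow> real"
  assumes "\<And>x. x \<in> set_pmf p \<Longrightarrow> f x = g x"
  shows "measure_pmf.expectation p f = measure_pmf.expectation p g"
  by (rule integral_cong_AE) (auto intro!: AE_pmfI assms)

lemma expectation_le_const:
  fixes f :: "'a \<Rightarrow> real"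
  assumes "\<And>x. x \<in> set_pmf p \<Longrightarrow> \<bar>f x\<bar> \<le> B"
    and "\<And>x. x \<in> set_pmf p \<Longrightarrow> f x \<le> c"
  shows "measure_pmf.expectation p f \<le> c"
  using measure_pmf.integral_le_const[OF integrable_pmf_bounded[of p f B]] assms
  by (auto simp: AE_measure_pmf_iff)

lemma expectation_bind_pmf:
  fixes f :: "'b \<Rightarrow> real"
  assumes "\<And>x y. x \<in> set_pmf M \<Longrightarrow> y \<in> set_pmf (N x) \<Longrightarrow> 0 \<le> f y \<and> f y \<le> B"
  shows "measure_pmf.expectation (bind_pmf M N) f
       = measure_pmf.expectation M (\<lambda>x. measure_pmf.expectation (N x) f)"
proof -
  have *: "ennreal (measure_pmf.expectation q g) = (\<integral>\<^sup>+y. ennreal (g y) \<partial>measure_pmf q)"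
    if "\<And>y. y \<in> set_pmf q \<Longrightarrow> 0 \<le> g y \<and> g y \<le> B" for q :: "'c pmf" and g :: "'c \<Rightarrow> real"
    using that by (intro nn_integral_eq_integral[symmetric] integrable_pmf_bounded[where B=B])
      (auto intro!: AE_pmfI)
  have i: "0 \<le> measure_pmf.expectation (N x) f \<and> measure_pmf.expectation (N x) f \<le> B"
    if "x \<in> set_pmf M" for x
    using assms[OF that]
    by (intro conjI expectation_le_const[where B=B] integral_nonneg_AE) (auto intro!: AE_pmfI)
  have "ennreal (measure_pmf.expectation (bind_pmf M N) f)
      = (\<integral>\<^sup>+x. \<integral>\<^sup>+y. ennreal (f y) \<partial>measure_pmf (N x) \<partial>measure_pmf M)"
    using assms by (subst *) auto
  also have "\<dots> = (\<integral>\<^sup>+x. ennreal (measure_pmf.expectation (N x) f) \<partial>measure_pmf M)"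
    by (intro nn_integral_cong_AE) (auto intro!: AE_pmfI *[symmetric] assms)
  also have "\<dots> = ennreal (measure_pmf.expectation M (\<lambda>x. measure_pmf.expectation (N x) f))"
    using i by (subst *) auto
  finally show ?thesis
    by (subst (asm) ennreal_inj)
       (use i assms in \<open>auto intro!: integral_nonneg_AE AE_pmfI\<close>)
qed

lemma expectation_density:
  fixes f :: "'a \<Rightarrow> real"
  shows "measure_pmf.expectation p f = (\<integral>y. pmf p y * f y \<partial>count_space UNIV)"
  unfolding measure_pmf_eq_density by (subst integral_density) auto

section \<open>Posterior bias and symmetric channels\<close>

lemma pmf_mix: "pmf (mix P) y = (pmf (P True) y + pmf (P False) y) / 2"
  unfolding mix_def by (subst pmf_bind, subst integral_pmf_of_set) (auto simp: UNIV_bool)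

lemma abs_bias_le: "\<bar>bias P y\<bar> \<le> 1"
  unfolding bias_def using pmf_nonneg[of "P True" y] pmf_nonneg[of "P False" y]
  by (auto simp: abs_le_iff divide_simps)

text \<open>Bayes' rule read backwards: relative to \<open>mix P\<close> the two inputs have
  densities 1 plus and 1 minus the bias, which reduces every capacity to an expectation under
  \<open>law P\<close>.\<close>

lemma pmf_bias: "pmf (P s) y = pmf (mix P) y * (1 + spin s * bias P y)"
proof (cases "pmf (P True) y + pmf (P False) y = 0")
  case True
  then have "pmf (P True) y = 0" "pmf (P False) y = 0"
    using pmf_nonneg[of "P True" y] pmf_nonneg[of "P False" y] by linarith+
  then show ?thesis by (cases s) (auto simp: pmf_mix)
next
  case False
  then show ?thesis by (cases s) (auto simp: pmf_mix bias_def spin_def field_simps)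
qed

lemma set_law: "set_pmf (law P) \<subseteq> {-1..1}"
  using abs_bias_le[of P] by (fastforce simp: law_def abs_le_iff)

lemma law_abs: "x \<in> set_pmf (law P) \<Longrightarrow> \<bar>x\<bar> \<le> 1"
  using subsetD[OF set_law, of x P] by (simp add: abs_le_iff)

lemma expectation_law:
  fixes f :: "real \<Rightarrow> real"
  shows "measure_pmf.expectation (law P) f = measure_pmf.expectation (mix P) (\<lambda>y. f (bias P y))"
  by (simp add: law_def)

lemma expectation_symmetric:
  fixes f :: "real \<Rightarrow> real"
  assumes "symmetric_channel P"
  shows "measure_pmf.expectation (law P) (\<lambda>x. f (- x)) = measure_pmf.expectation (law P) f"
proof -
  have "measure_pmf.expectation (map_pmf uminus (law P)) f = measure_pmf.expectation (law P) (\<lambda>x. f (- x))"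
    by (simp only: integral_map_pmf)
  then show ?thesis using assms unfolding symmetric_channel_def by metis
qed

lemma mix_flip:
  assumes "\<And>s. P (\<not> s) = map_pmf \<phi> (P s)"
  shows "map_pmf \<phi> (mix P) = mix P"
proof (rule pmf_eqI)
  fix z
  have "map_pmf \<phi> (mix P) = bind_pmf (pmf_of_set UNIV) (\<lambda>s. P (\<not> s))"
    unfolding mix_def map_bind_pmf assms ..
  then have "pmf (map_pmf \<phi> (mix P)) z = pmf (mix (\<lambda>s. P (\<not> s))) z" by (simp add: mix_def)
  then show "pmf (map_pmf \<phi> (mix P)) z = pmf (mix P) z" by (simp add: pmf_mix)
qed

lemma symmetric_channelI:
  assumes "inj \<phi>" "\<And>s. P (\<not> s) = map_pmf \<phi> (P s)"
  shows "symmetric_channel P"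
proof -
  have T: "P False = map_pmf \<phi> (P True)" "P True = map_pmf \<phi> (P False)"
    using assms(2)[of True] assms(2)[of False] by auto
  have t: "bias P (\<phi> y) = - bias P y" for y
  proof -
    have "pmf (P False) (\<phi> y) = pmf (P True) y" by (metis T(1) assms(1) pmf_map_inj')
    moreover have "pmf (P True) (\<phi> y) = pmf (P False) y" by (metis T(2) assms(1) pmf_map_inj')
    ultimately show ?thesis
      by (simp add: bias_def minus_divide_left add.commute)
  qed
  have "map_pmf uminus (law P) = map_pmf (\<lambda>y. bias P (\<phi> y)) (mix P)"
    by (simp add: law_def map_pmf_comp t)
  also have "\<dots> = map_pmf (bias P) (map_pmf \<phi> (mix P))" by (simp add: map_pmf_comp)
  finally show ?thesis by (simp add: mix_flip[of P \<phi>, OF assms(2)] law_def symmetric_channel_def)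
qed

lemma replicate_pmf_Suc_pair: "replicate_pmf (Suc n) p = map_pmf (\<lambda>z. fst z # snd z) (pair_pmf p (replicate_pmf n p))"
  by (simp add: pair_pmf_def map_bind_pmf bind_return_pmf)

text \<open>What the recursion needs of an information measure. \<open>bound\<close> gives
  integrability and a ceiling of 4/3 on every capacity; \<open>quartic_kernel\<close> attains its
  constant at \<open>v = 0\<close>. \<open>subadd\<close> is the pair inequality for fixed biases,
  averaged over the sign of one of them.\<close>

locale divergence_kernel =
  fixes F :: "real \<Rightarrow> real \<Rightarrow> real"
  assumes hom: "0 \<le> c \<Longrightarrow> F (c * u) (c * v) = c * F u v"
    and nonneg: "0 \<le> u \<Longrightarrow> 0 \<le> v \<Longrightarrow> 0 \<le> F u v"
    and bound: "0 \<le> u \<Longrightarrow> 0 \<le> v \<Longrightarrow> F u v \<le> 2 / 3 * (u + v)"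
    and diag: "F 1 1 = 0"
    and subadd: "\<bar>a\<bar> \<le> 1 \<Longrightarrow> \<bar>b\<bar> \<le> 1 \<Longrightarrow>
      (F ((1 + a) * (1 + b)) ((1 - a) * (1 - b)) + F ((1 + a) * (1 - b)) ((1 - a) * (1 + b))) / 2
        \<le> F (1 + a) (1 - a) + F (1 + b) (1 - b)"
begin

lemma cap_density:
  assumes "\<And>s y. pmf (P s) y = pmf p y * a s y"
  shows "cap F P = measure_pmf.expectation p (\<lambda>y. F (a True y) (a False y))"
  unfolding cap_def expectation_density by (simp add: assms hom)

lemma cap_law: "cap F P = measure_pmf.expectation (law P) (\<lambda>x. F (1 + x) (1 - x))"
  unfolding expectation_law by (subst cap_density[OF pmf_bias]) (simp add: spin_def)

lemma bounded: "\<bar>x\<bar> \<le> 1 \<Longrightarrow> 0 \<le> F (1 + x) (1 - x) \<and> F (1 + x) (1 - x) \<le> 4/3"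
  using bound[of "1+x" "1-x"] nonneg[of "1+x" "1-x"] by (auto simp: abs_le_iff)

lemma cap_bounds: "0 \<le> cap F P \<and> cap F P \<le> 4/3"
  unfolding cap_law
  by (intro conjI expectation_le_const[where B="4/3"] integral_nonneg_AE)
     (use bounded law_abs[of _ P] in \<open>auto intro!: AE_pmfI simp del: divide_less_eq_numeral1\<close>)

lemma cap_map_inj:
  assumes "inj f"
  shows "cap F (\<lambda>s. map_pmf f (P s)) = cap F P"
proof -
  have "pmf (map_pmf f (P s)) z = pmf (map_pmf f (mix P)) z * (1 + spin s * bias P (inv f z))" for s z
  proof (cases "z \<in> range f")
    case True
    then show ?thesis using assms by (auto simp: pmf_map_inj' pmf_bias[of P])
  next
    case False
    then show ?thesis by (subst (1 2) pmf_map_outside) auto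
  qed
  from cap_density[OF this] show ?thesis
    using assms unfolding cap_density[of P, OF pmf_bias] by simp
qed

text \<open>Given the two biases, the pair has likelihoods \<open>(1 + a) * (1 + b)\<close> and
  \<open>(1 - a) * (1 - b)\<close> relative to the product of the mixtures. Symmetry of one factor
  permits averaging over the sign of \<open>a\<close>, and \<open>subadd\<close> then applies
  pointwise.\<close>

lemma cap_pair:
  fixes P :: "bool \<Rightarrow> 'a pmf" and Q :: "bool \<Rightarrow> 'b pmf"
  assumes "symmetric_channel P"
  shows "cap F (\<lambda>s. pair_pmf (P s) (Q s)) \<le> cap F P + cap F Q"
proof -
  let ?a = "\<lambda>s z. (1 + spin s * bias P (fst z)) * (1 + spin s * bias Q (snd z))"
  let ?G = "\<lambda>a b. F ((1 + a) * (1 + b)) ((1 - a) * (1 - b))"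
  let ?L = "pair_pmf (law P) (law Q)"
  have b: "\<bar>fst z\<bar> \<le> 1 \<and> \<bar>snd z\<bar> \<le> 1" if "z \<in> set_pmf ?L" for z
    using that law_abs[of _ P] law_abs[of _ Q] by auto
  have Gb: "0 \<le> ?G a b \<and> ?G a b \<le> 4" if "\<bar>a\<bar> \<le> 1" "\<bar>b\<bar> \<le> 1" for a b
  proof -
    have "0 \<le> (1 + a) * (1 + b)" "0 \<le> (1 - a) * (1 - b)" "a * b \<le> 1"
      using that abs_le_iff mult_mono[OF that] by (auto simp: abs_le_iff simp flip: abs_mult)
    then show ?thesis
      using bound[of "(1 + a) * (1 + b)" "(1 - a) * (1 - b)"]
        nonneg[of "(1 + a) * (1 + b)" "(1 - a) * (1 - b)"] by (auto simp: algebra_simps)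
  qed
  have "pmf (pair_pmf (P s) (Q s)) z = pmf (pair_pmf (mix P) (mix Q)) z * ?a s z" for s z
    by (cases z) (simp add: pmf_pair pmf_bias[of P] pmf_bias[of Q])
  then have "cap F (\<lambda>s. pair_pmf (P s) (Q s))
      = measure_pmf.expectation (pair_pmf (mix P) (mix Q)) (\<lambda>z. ?G (bias P (fst z)) (bias Q (snd z)))"
    by (subst cap_density) (auto simp: spin_def)
  also have "\<dots> = measure_pmf.expectation ?L (\<lambda>z. ?G (fst z) (snd z))"
    unfolding law_def map_pair[symmetric] by (simp add: case_prod_unfold)
  finally have 1: "cap F (\<lambda>s. pair_pmf (P s) (Q s)) = measure_pmf.expectation ?L (\<lambda>z. ?G (fst z) (snd z))" .
  have "?L = pair_pmf (map_pmf uminus (law P)) (map_pmf (\<lambda>x. x) (law Q))"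
    using assms by (simp add: symmetric_channel_def)
  then have L: "?L = map_pmf (\<lambda>(a, b). (- a, b)) ?L"
    by (simp only: map_pair[symmetric])
  have "measure_pmf.expectation ?L (\<lambda>z. ?G (fst z) (snd z))
      = measure_pmf.expectation ?L (\<lambda>z. ?G (- fst z) (snd z))"
    by (subst L) (simp add: case_prod_unfold)
  then have "2 * cap F (\<lambda>s. pair_pmf (P s) (Q s))
     = measure_pmf.expectation ?L (\<lambda>z. ?G (fst z) (snd z)) + measure_pmf.expectation ?L (\<lambda>z. ?G (- fst z) (snd z))"
    using 1 by simp
  also have "\<dots> = measure_pmf.expectation ?L (\<lambda>z. ?G (fst z) (snd z) + ?G (- fst z) (snd z))"
    using Gb b by (intro Bochner_Integration.integral_add[symmetric] integrable_pmf_bounded[where B=4])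
      (metis abs_of_nonneg, metis abs_of_nonneg abs_minus_cancel)
  also have "\<dots> \<le> measure_pmf.expectation ?L
     (\<lambda>z. 2 * (F (1 + fst z) (1 - fst z) + F (1 + snd z) (1 - snd z)))"
  proof (rule expectation_mono_pmf[where B=8 and C=8])
    fix z assume "z \<in> set_pmf ?L"
    then have z: "\<bar>fst z\<bar> \<le> 1" "\<bar>snd z\<bar> \<le> 1" "\<bar>- fst z\<bar> \<le> 1" using b by auto
    show "?G (fst z) (snd z) + ?G (- fst z) (snd z)
        \<le> 2 * (F (1 + fst z) (1 - fst z) + F (1 + snd z) (1 - snd z))"
      using subadd[of "snd z" "fst z"] z by (simp add: mult.commute)
    show "\<bar>?G (fst z) (snd z) + ?G (- fst z) (snd z)\<bar> \<le> 8"
      using Gb[OF z(1,2)] Gb[OF z(3,2)] by (auto simp: abs_le_iff)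
    show "\<bar>2 * (F (1 + fst z) (1 - fst z) + F (1 + snd z) (1 - snd z))\<bar> \<le> 8"
      using bounded[OF z(1)] bounded[OF z(2)] by (auto simp: abs_le_iff)
  qed
  also have "\<dots> = 2 * (measure_pmf.expectation ?L (\<lambda>z. F (1 + fst z) (1 - fst z))
      + measure_pmf.expectation ?L (\<lambda>z. F (1 + snd z) (1 - snd z)))"
    by (subst integral_mult_right_zero, subst Bochner_Integration.integral_add)
       (use b bounded in \<open>auto intro!: integrable_pmf_bounded[where B="4/3"]\<close>)
  also have "measure_pmf.expectation ?L (\<lambda>z. F (1 + fst z) (1 - fst z))
      = measure_pmf.expectation (map_pmf fst ?L) (\<lambda>x. F (1 + x) (1 - x))" by simp
  also have "\<dots> = cap F P" by (simp only: map_fst_pair_pmf cap_law)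
  also have "measure_pmf.expectation ?L (\<lambda>z. F (1 + snd z) (1 - snd z))
      = measure_pmf.expectation (map_pmf snd ?L) (\<lambda>x. F (1 + x) (1 - x))" by simp
  also have "\<dots> = cap F Q" by (simp only: map_snd_pair_pmf cap_law)
  finally show ?thesis by simp
qed

lemma cap_replicate:
  fixes Q :: "bool \<Rightarrow> 'a pmf"
  assumes "symmetric_channel Q"
  shows "cap F (\<lambda>s. replicate_pmf t (Q s)) \<le> real t * cap F Q"
proof (induction t)
  case 0
  have "cap F (\<lambda>s. replicate_pmf 0 (Q s)) = measure_pmf.expectation (return_pmf ([] :: 'a list)) (\<lambda>y. F 1 1)"
    by (rule cap_density[where a="\<lambda>_ _. 1"]) simp
  then show ?case by (simp add: diag)
next
  case (Suc t)
  have "cap F (\<lambda>s. replicate_pmf (Suc t) (Q s)) = cap F (\<lambda>s. pair_pmf (Q s) (replicate_pmf t (Q s)))"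
    unfolding replicate_pmf_Suc_pair by (rule cap_map_inj) (auto simp: inj_def)
  also have "\<dots> \<le> cap F Q + cap F (\<lambda>s. replicate_pmf t (Q s))"
    by (rule cap_pair[OF assms])
  finally show ?case using Suc by (simp add: algebra_simps)
qed

text \<open>The number of copies has the same law under both spins and can be read off the output as
  its length, so the capacity is the \<open>D\<close>-average of the capacities for fixed
  \<open>t\<close>.\<close>

lemma cap_random_replicate:
  fixes Q :: "bool \<Rightarrow> 'a pmf" and D :: "nat pmf"
  assumes "symmetric_channel Q" "integrable (measure_pmf D) real"
  shows "cap F (\<lambda>s. bind_pmf D (\<lambda>t. replicate_pmf t (Q s))) \<le> measure_pmf.expectation D real * cap F Q"
proof -
  let ?R = "\<lambda>t s. replicate_pmf t (Q s)"
  let ?p = "bind_pmf D (\<lambda>t. mix (?R t))"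
  let ?th = "\<lambda>hs. bias (?R (length hs)) hs"
  have z: "pmf (?R t s) hs = 0" if "t \<noteq> length hs" for t s hs
    using that by (auto simp: set_replicate_pmf simp flip: set_pmf_iff intro!: pmf_eq_0_set_pmf[THEN iffD2])
  have z': "pmf (mix (?R t)) hs = 0" if "t \<noteq> length hs" for t hs
    using z[OF that] by (simp add: pmf_mix)
  have A: "pmf (bind_pmf D (\<lambda>t. ?R t s)) hs = pmf D (length hs) * pmf (?R (length hs) s) hs" for s hs
    unfolding pmf_bind using z by (subst integral_measure_pmf_real[of "{length hs}"]) (auto split: if_splits)
  have B: "pmf ?p hs = pmf D (length hs) * pmf (mix (?R (length hs))) hs" for hs
    unfolding pmf_bind using z' by (subst integral_measure_pmf_real[of "{length hs}"]) (auto split: if_splits)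
  have len: "length hs = t" if "hs \<in> set_pmf (mix (?R t))" for hs t
    using z'[of t hs] that by (auto simp: set_pmf_iff)
  have "pmf (bind_pmf D (\<lambda>t. ?R t s)) hs = pmf ?p hs * (1 + spin s * ?th hs)" for s hs
    unfolding A B using pmf_bias[of "?R (length hs)" s hs] by simp
  then have "cap F (\<lambda>s. bind_pmf D (\<lambda>t. ?R t s)) = measure_pmf.expectation ?p (\<lambda>hs. F (1 + ?th hs) (1 - ?th hs))"
    by (subst cap_density) (auto simp: spin_def)
  also have "\<dots> = measure_pmf.expectation D (\<lambda>t. measure_pmf.expectation (mix (?R t)) (\<lambda>hs. F (1 + ?th hs) (1 - ?th hs)))"
    by (rule expectation_bind_pmf[where B="4/3"]) (intro bounded abs_bias_le)
  also have "\<dots> = measure_pmf.expectation D (\<lambda>t. cap F (?R t))"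
    by (intro Bochner_Integration.integral_cong refl)
       (auto simp: cap_law expectation_law len intro!: expectation_cong_pmf)
  also have "\<dots> \<le> measure_pmf.expectation D (\<lambda>t. real t * cap F Q)"
  proof (rule integral_mono)
    show "integrable (measure_pmf D) (\<lambda>t. cap F (?R t))"
    proof (rule integrable_pmf_bounded)
      show "\<bar>cap F (?R t)\<bar> \<le> 4/3" for t
        using cap_bounds[of "?R t"] by linarith
    qed
  qed (use assms cap_replicate in auto)
  finally show ?thesis by simp
qed

end

section \<open>The chi-square kernel and its quartic correction\<close>

text \<open>The function, homogeneous of degree one, that equals \<open>a\<^sup>2\<close> at
  \<open>(1 + a, 1 - a)\<close>; \<open>quartic_kernel\<close> is the same for
  \<open>a\<^sup>2 + a ^ 4 / 3\<close>.\<close>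

definition chi_kernel :: "real \<Rightarrow> real \<Rightarrow> real" where
  "chi_kernel u v = (u - v)\<^sup>2 / (2 * (u + v))"

definition quartic_kernel :: "real \<Rightarrow> real \<Rightarrow> real" where
  "quartic_kernel u v = chi_kernel u v + (u - v) ^ 4 / (6 * (u + v) ^ 3)"

lemma chi_kernel_one_pm: "chi_kernel (1 + a) (1 - a) = a\<^sup>2"
  by (simp add: chi_kernel_def power2_eq_square)

lemma quartic_kernel_one_pm: "quartic_kernel (1 + a) (1 - a) = a\<^sup>2 + a ^ 4 / 3"
proof -
  have "(2 * a) ^ 4 = 16 * a ^ 4" by (simp add: power_mult_distrib)
  then show ?thesis by (simp add: quartic_kernel_def chi_kernel_one_pm)
qed

lemma chi_kernel_product:
  "chi_kernel ((1 + a) * (1 + b)) ((1 - a) * (1 - b)) = (a + b)\<^sup>2 / (1 + a * b)"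
proof -
  have *: "(1 + a) * (1 + b) - (1 - a) * (1 - b) = 2 * (a + b)"
    "(1 + a) * (1 + b) + (1 - a) * (1 - b) = 2 * (1 + a * b)" by algebra+
  have "(2 * y)\<^sup>2 / (2 * (2 * z)) = y\<^sup>2 / z" for y z :: real
    by (simp add: power_mult_distrib)
  then show ?thesis by (simp only: chi_kernel_def *)
qed

lemma quartic_kernel_product:
  "quartic_kernel ((1 + a) * (1 + b)) ((1 - a) * (1 - b))
    = (a + b)\<^sup>2 / (1 + a * b) + (a + b) ^ 4 / (3 * (1 + a * b) ^ 3)"
proof -
  have *: "(1 + a) * (1 + b) - (1 - a) * (1 - b) = 2 * (a + b)"
    "(1 + a) * (1 + b) + (1 - a) * (1 - b) = 2 * (1 + a * b)" by algebra+
  have "(2 * y) ^ 4 / (6 * (2 * z) ^ 3) = y ^ 4 / (3 * z ^ 3)" for y z :: real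
    by (simp add: power_mult_distrib)
  then show ?thesis by (simp only: quartic_kernel_def chi_kernel_product *)
qed

lemma abs_mult_le_1: "\<bar>a\<bar> \<le> 1 \<Longrightarrow> \<bar>b\<bar> \<le> 1 \<Longrightarrow> \<bar>a * b\<bar> \<le> (1 :: real)"
  using mult_mono[of "\<bar>a\<bar>" 1 "\<bar>b\<bar>" 1] by (simp add: abs_mult)

lemma abs_mult_eq_1:
  assumes "\<bar>a\<bar> \<le> 1" "\<bar>b\<bar> \<le> 1" "\<not> \<bar>a * b\<bar> < (1 :: real)"
  shows "(a = 1 \<or> a = -1) \<and> (b = 1 \<or> b = -1)"
proof -
  have "\<bar>a\<bar> * \<bar>b\<bar> = 1" using abs_mult_le_1[OF assms(1,2)] assms(3) by (simp add: abs_mult)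
  moreover have "\<bar>a\<bar> * \<bar>b\<bar> \<le> \<bar>a\<bar>" "\<bar>a\<bar> * \<bar>b\<bar> \<le> \<bar>b\<bar>"
    using assms by (simp_all add: mult_left_le mult_left_le_one_le)
  ultimately show ?thesis using assms by linarith
qed

text \<open>Exhibits the defect in subadditivity with a visible sign; the quartic case needs its
  exact value to offset the excess of the fourth-order terms.\<close>

lemma chi_product_average:
  fixes a b :: real
  assumes "\<bar>a * b\<bar> < 1"
  shows "((a + b)\<^sup>2 / (1 + a * b) + (a - b)\<^sup>2 / (1 - a * b)) / 2
    = a\<^sup>2 + b\<^sup>2 - a\<^sup>2 * b\<^sup>2 * (2 - (a\<^sup>2 + b\<^sup>2)) / (1 - a\<^sup>2 * b\<^sup>2)"
proof -
  have u: "1 + a * b \<noteq> 0" "1 - a * b \<noteq> 0" using assms by auto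
  have p: "1 - a\<^sup>2 * b\<^sup>2 = (1 + a * b) * (1 - a * b)" by algebra
  show ?thesis unfolding p using u by (simp add: divide_simps) algebra
qed

lemma chi_subadd:
  fixes a b :: real
  assumes "\<bar>a\<bar> \<le> 1" "\<bar>b\<bar> \<le> 1"
  shows "((a + b)\<^sup>2 / (1 + a * b) + (a - b)\<^sup>2 / (1 - a * b)) / 2 \<le> a\<^sup>2 + b\<^sup>2"
proof (cases "\<bar>a * b\<bar> < 1")
  case True
  have "a\<^sup>2 \<le> 1" "b\<^sup>2 \<le> 1" using assms by (simp_all add: abs_square_le_1)
  moreover have "a\<^sup>2 * b\<^sup>2 \<le> 1" using calculation by (simp add: mult_le_one)
  ultimately have "0 \<le> a\<^sup>2 * b\<^sup>2 * (2 - (a\<^sup>2 + b\<^sup>2)) / (1 - a\<^sup>2 * b\<^sup>2)"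
    by (intro divide_nonneg_nonneg mult_nonneg_nonneg) auto
  then show ?thesis unfolding chi_product_average[OF True] by simp
next
  \<comment> \<open>Both biases are now 1 or -1, and one of the two quotients has numerator and
    denominator 0; its value is 0 by convention.\<close>
  case False
  then show ?thesis using abs_mult_eq_1[OF assms False] by auto
qed

text \<open>Here \<open>q = \<bar>a b\<bar>\<close> and \<open>s = a\<^sup>2 + b\<^sup>2\<close>. The polynomial is convex in \<open>s\<close>, and at the two ends
  of the admissible interval it equals \<open>2 q (q - 1)^3 (q + 3)^2\<close> and \<open>(q^2 - 1)^3 (q^2 + 3)\<close>.\<close>

lemma quartic_slack_polynomial:
  fixes q s :: real
  assumes "0 \<le> q" "q < 1" "2 * q \<le> s" "s \<le> 1 + q\<^sup>2"
  shows "s\<^sup>2 * (6 - 3 * q\<^sup>2 + q ^ 4) + 18 * q\<^sup>2 - 2 * q ^ 6 - 9 * s - 10 * q\<^sup>2 * s + 3 * q ^ 4 * s \<le> 0"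
    (is "?P \<le> 0")
proof -
  have "(1 - q)\<^sup>2 * ?P = (1 + q\<^sup>2 - s) * (2 * q * (q - 1) ^ 3 * (q + 3)\<^sup>2)
      + (s - 2 * q) * ((q\<^sup>2 - 1) ^ 3 * (q\<^sup>2 + 3))
      - (1 - q)\<^sup>2 * (6 - 3 * q\<^sup>2 + q ^ 4) * ((s - 2 * q) * (1 + q\<^sup>2 - s))"
    by algebra
  moreover have "(1 + q\<^sup>2 - s) * (2 * q * (q - 1) ^ 3 * (q + 3)\<^sup>2) \<le> 0"
    using assms by (intro mult_nonneg_nonpos mult_nonpos_nonneg) (auto simp: power_le_zero_eq)
  moreover have q2: "q\<^sup>2 \<le> 1" using assms by (simp add: power_le_one)
  moreover have "(s - 2 * q) * ((q\<^sup>2 - 1) ^ 3 * (q\<^sup>2 + 3)) \<le> 0"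
    using assms q2 by (intro mult_nonneg_nonpos mult_nonpos_nonneg) (auto simp: power_le_zero_eq)
  moreover have "0 \<le> (1 - q)\<^sup>2 * (6 - 3 * q\<^sup>2 + q ^ 4) * ((s - 2 * q) * (1 + q\<^sup>2 - s))"
    using assms q2 by (intro mult_nonneg_nonneg) (auto intro: add_nonneg_nonneg)
  ultimately have "(1 - q)\<^sup>2 * ?P \<le> 0" by linarith
  moreover have "0 < (1 - q)\<^sup>2" using assms by simp
  ultimately show ?thesis by (simp add: mult_le_0_iff)
qed

text \<open>Everything depends on \<open>p = a\<^sup>2 * b\<^sup>2\<close> and
  \<open>s = a\<^sup>2 + b\<^sup>2\<close>. The defect of the quadratic terms pays for the quartic
  ones: after clearing denominators the slack is \<open>p\<close> times the negative of the
  polynomial in \<open>quartic_slack_polynomial\<close>, with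
  \<open>q = \<bar>a * b\<bar>\<close>.\<close>

lemma quartic_subadd:
  fixes a b :: real
  assumes "\<bar>a\<bar> \<le> 1" "\<bar>b\<bar> \<le> 1"
  shows "((a + b)\<^sup>2 / (1 + a * b) + (a + b) ^ 4 / (3 * (1 + a * b) ^ 3)
      + ((a - b)\<^sup>2 / (1 - a * b) + (a - b) ^ 4 / (3 * (1 - a * b) ^ 3))) / 2
      \<le> a\<^sup>2 + a ^ 4 / 3 + (b\<^sup>2 + b ^ 4 / 3)"
proof (cases "\<bar>a * b\<bar> < 1")
  case True
  define p s where "p = a\<^sup>2 * b\<^sup>2" and "s = a\<^sup>2 + b\<^sup>2"
  have u: "1 + a * b > 0" "1 - a * b > 0" using True by auto
  have p: "1 - p = (1 + a * b) * (1 - a * b)" unfolding p_def by algebra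
  have p1: "1 - p > 0" unfolding p using u by simp
  have pq: "p = \<bar>a * b\<bar>\<^sup>2" "p\<^sup>2 = \<bar>a * b\<bar> ^ 4" "p ^ 3 = \<bar>a * b\<bar> ^ 6"
    by (simp_all add: p_def power_mult_distrib flip: power_mult power_abs)
  have "2 * \<bar>a * b\<bar> \<le> s" unfolding s_def
    using sum_squares_bound[of "\<bar>a\<bar>" "\<bar>b\<bar>"] by (simp add: abs_mult mult.assoc)
  moreover have "s \<le> 1 + p"
  proof -
    have "0 \<le> (1 - a\<^sup>2) * (1 - b\<^sup>2)" using assms by (simp add: abs_square_le_1)
    then show ?thesis by (simp add: s_def p_def algebra_simps)
  qed
  ultimately have key: "s\<^sup>2 * (6 - 3 * p + p\<^sup>2) + 18 * p - 2 * p ^ 3 - 9 * s - 10 * p * s + 3 * p\<^sup>2 * s \<le> 0"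
    using quartic_slack_polynomial[of "\<bar>a * b\<bar>" s] True unfolding pq by simp
  let ?N = "(s\<^sup>2 + 4 * p) * (1 + 3 * p) - 4 * p * s * (3 + p)"
  have "((a + b) ^ 4 / (3 * (1 + a * b) ^ 3) + (a - b) ^ 4 / (3 * (1 - a * b) ^ 3)) / 2
      = ((a + b) ^ 4 * (1 - a * b) ^ 3 + (a - b) ^ 4 * (1 + a * b) ^ 3) / (6 * (1 - p) ^ 3)"
    unfolding p using u by (simp add: divide_simps power_mult_distrib)
  also have "(a + b) ^ 4 * (1 - a * b) ^ 3 + (a - b) ^ 4 * (1 + a * b) ^ 3 = 2 * ?N"
    unfolding s_def p_def by algebra
  finally have e4: "((a + b) ^ 4 / (3 * (1 + a * b) ^ 3) + (a - b) ^ 4 / (3 * (1 - a * b) ^ 3)) / 2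
      = ?N / (3 * (1 - p) ^ 3)"
    by (simp only: mult_divide_mult_cancel_left_if[of 2 ?N "3 * (1 - p) ^ 3", symmetric])
  have "?N / (3 * (1 - p) ^ 3) \<le> p * (2 - s) / (1 - p) + (s\<^sup>2 - 2 * p) / 3"
  proof -
    have "3 * p * (2 - s) * (1 - p)\<^sup>2 + (s\<^sup>2 - 2 * p) * (1 - p) ^ 3 - ?N
      = p * - (s\<^sup>2 * (6 - 3 * p + p\<^sup>2) + 18 * p - 2 * p ^ 3 - 9 * s - 10 * p * s + 3 * p\<^sup>2 * s)"
      by algebra
    moreover have "0 \<le> p" by (simp add: p_def)
    ultimately have "?N \<le> 3 * p * (2 - s) * (1 - p)\<^sup>2 + (s\<^sup>2 - 2 * p) * (1 - p) ^ 3"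
      using key mult_nonneg_nonneg[of p "- (s\<^sup>2 * (6 - 3 * p + p\<^sup>2) + 18 * p - 2 * p ^ 3 - 9 * s - 10 * p * s + 3 * p\<^sup>2 * s)"]
      by linarith
    then have "?N / (3 * (1 - p) ^ 3) \<le> (3 * p * (2 - s) * (1 - p)\<^sup>2 + (s\<^sup>2 - 2 * p) * (1 - p) ^ 3) / (3 * (1 - p) ^ 3)"
      using p1 by (intro divide_right_mono) auto
    also have "\<dots> = p * (2 - s) / (1 - p) + (s\<^sup>2 - 2 * p) / 3"
    proof -
      have "(3 * x * y * r\<^sup>2 + z * r ^ 3) / (3 * r ^ 3) = x * y / r + z / 3" if "r > 0" for x y z r :: real
        using that by (simp add: field_simps power2_eq_square power3_eq_cube)
      then show ?thesis using p1 by blast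
    qed
    finally show ?thesis .
  qed
  moreover have "s\<^sup>2 - 2 * p = a ^ 4 + b ^ 4" unfolding s_def p_def by algebra
  ultimately show ?thesis
    using chi_product_average[OF True] e4 by (simp add: s_def p_def add_divide_distrib)
next
  case False
  then show ?thesis using abs_mult_eq_1[OF assms False] by auto
qed

interpretation chi: divergence_kernel chi_kernel
proof
  show "chi_kernel (c * u) (c * v) = c * chi_kernel u v" if "0 \<le> c" for c u v
  proof (cases "c = 0")
    case False
    have "(c * d)\<^sup>2 / (2 * (c * e)) = c * (d\<^sup>2 / (2 * e))" for d e
      using False by (simp add: power2_eq_square)
    from this[of "u - v" "u + v"] show ?thesis
      by (simp only: chi_kernel_def distrib_left right_diff_distrib)
  qed (simp add: chi_kernel_def)
  show "0 \<le> chi_kernel u v" if "0 \<le> u" "0 \<le> v" for u v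
    using that by (simp add: chi_kernel_def)
  show "chi_kernel u v \<le> 2 / 3 * (u + v)" if "0 \<le> u" "0 \<le> v" for u v
  proof (cases "u + v = 0")
    case False
    have "(u + v)\<^sup>2 = (u - v)\<^sup>2 + 4 * (u * v)" by algebra
    then have le: "(u - v)\<^sup>2 * 3 \<le> 4 * (u + v)\<^sup>2"
      using mult_nonneg_nonneg[OF that] zero_le_power2[of "u - v"] by linarith
    have *: "x / (2 * e) \<le> 2 / 3 * e" if "x * 3 \<le> 4 * e\<^sup>2" "0 < e" for x e :: real
      using that by (simp add: divide_simps power2_eq_square)
    show ?thesis unfolding chi_kernel_def using False that by (intro * le) simp
  qed (simp add: chi_kernel_def)
  show "chi_kernel 1 1 = 0" by (simp add: chi_kernel_def)
  fix a b :: real assume "\<bar>a\<bar> \<le> 1" "\<bar>b\<bar> \<le> 1"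
  then show "(chi_kernel ((1 + a) * (1 + b)) ((1 - a) * (1 - b)) + chi_kernel ((1 + a) * (1 - b)) ((1 - a) * (1 + b))) / 2
      \<le> chi_kernel (1 + a) (1 - a) + chi_kernel (1 + b) (1 - b)"
    using chi_kernel_product[of a b] chi_kernel_product[of a "- b"] chi_subadd[of a b]
    by (simp add: chi_kernel_one_pm)
qed

interpretation quartic: divergence_kernel quartic_kernel
proof
  show "quartic_kernel (c * u) (c * v) = c * quartic_kernel u v" if "0 \<le> c" for c u v
  proof (cases "c = 0")
    case True
    then show ?thesis by (simp add: quartic_kernel_def chi.hom chi_kernel_def)
  next
    case False
    have "(c * d) ^ 4 / (6 * (c * e) ^ 3) = c * (d ^ 4 / (6 * e ^ 3))" for d e
    proof -
      have "c ^ 4 = c * c ^ 3" by (simp add: power3_eq_cube power4_eq_xxxx)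
      then show ?thesis using False by (simp add: power_mult_distrib)
    qed
    from this[of "u - v" "u + v"] show ?thesis
      using that by (simp only: quartic_kernel_def chi.hom distrib_left right_diff_distrib)
  qed
  show "0 \<le> quartic_kernel u v" if "0 \<le> u" "0 \<le> v" for u v
    using that by (simp add: quartic_kernel_def chi.nonneg)
  show "quartic_kernel u v \<le> 2 / 3 * (u + v)" if "0 \<le> u" "0 \<le> v" for u v
  proof (cases "u + v = 0")
    case False
    then have pos: "u + v > 0" using that by simp
    have "(u + v)\<^sup>2 = (u - v)\<^sup>2 + 4 * (u * v)" by algebra
    then have le: "(u - v)\<^sup>2 \<le> (u + v)\<^sup>2" using mult_nonneg_nonneg[OF that] by linarith
    then have "((u - v)\<^sup>2)\<^sup>2 \<le> ((u + v)\<^sup>2)\<^sup>2" by (intro power_mono le) simp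
    then have le4: "(u - v) ^ 4 \<le> (u + v) ^ 4" by (simp flip: power_mult)
    have "quartic_kernel u v \<le> (u + v)\<^sup>2 / (2 * (u + v)) + (u + v) ^ 4 / (6 * (u + v) ^ 3)"
      unfolding quartic_kernel_def chi_kernel_def
      by (rule add_mono; rule divide_right_mono[OF le] divide_right_mono[OF le4]) (use pos in auto)
    also have "\<dots> = 2 / 3 * (u + v)"
    proof -
      have "e\<^sup>2 / (2 * e) + e ^ 4 / (6 * e ^ 3) = 2 / 3 * e" if "0 < e" for e :: real
        using that by (simp add: field_simps power2_eq_square power3_eq_cube power4_eq_xxxx)
      then show ?thesis using pos .
    qed
    finally show ?thesis .
  qed (simp add: quartic_kernel_def chi_kernel_def)
  show "quartic_kernel 1 1 = 0" by (simp add: quartic_kernel_def chi_kernel_def)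
  fix a b :: real assume "\<bar>a\<bar> \<le> 1" "\<bar>b\<bar> \<le> 1"
  then show "(quartic_kernel ((1 + a) * (1 + b)) ((1 - a) * (1 - b)) + quartic_kernel ((1 + a) * (1 - b)) ((1 - a) * (1 + b))) / 2
      \<le> quartic_kernel (1 + a) (1 - a) + quartic_kernel (1 + b) (1 - b)"
    using quartic_kernel_product[of a b] quartic_kernel_product[of a "- b"] quartic_subadd[of a b]
    by (simp add: quartic_kernel_one_pm)
qed

text \<open>As a function of \<open>x\<^sup>2\<close> the left side is a constant plus
  \<open>x\<^sup>2\<close> times a nondecreasing factor (identity \<open>E\<close>); the right side
  is its chord between 0 and 1.\<close>

lemma chi_bsc_le_bec_aux:
  fixes D \<delta> S s x :: real
  assumes "\<bar>s\<bar> < S" "\<bar>x\<bar> \<le> 1"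
  shows "((D + x * \<delta>)\<^sup>2 / (S + x * s) + (D - x * \<delta>)\<^sup>2 / (S - x * s)) / 2
    \<le> (1 - x\<^sup>2) * (D\<^sup>2 / S) + x\<^sup>2 * (((D + \<delta>)\<^sup>2 / (S + s) + (D - \<delta>)\<^sup>2 / (S - s)) / 2)"
proof -
  have E: "((D + y * \<delta>)\<^sup>2 / (S + y * s) + (D - y * \<delta>)\<^sup>2 / (S - y * s)) / 2
      = D\<^sup>2 / S + y\<^sup>2 * ((\<delta> * S - D * s)\<^sup>2 / (S * (S\<^sup>2 - y\<^sup>2 * s\<^sup>2)))" if "\<bar>y\<bar> \<le> 1" for y
  proof -
    have "\<bar>y * s\<bar> < S" using that assms(1) mult_right_mono[OF that, of "\<bar>s\<bar>"] by (simp add: abs_mult)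
    then have nz: "S + y * s > 0" "S - y * s > 0" "S > 0" by (auto simp: abs_less_iff)
    have f: "S\<^sup>2 - y\<^sup>2 * s\<^sup>2 = (S + y * s) * (S - y * s)" by algebra
    show ?thesis unfolding f using nz by (simp add: divide_simps) algebra
  qed
  have S: "0 < S" using assms by simp
  have s2: "s\<^sup>2 < S\<^sup>2" using assms(1) power2_strict_mono[of s S] by simp
  have x2: "x\<^sup>2 \<le> 1" using assms(2) by (simp add: abs_square_le_1)
  have xs: "x\<^sup>2 * s\<^sup>2 \<le> s\<^sup>2" using x2 by (simp add: mult_left_le_one_le)
  have "(\<delta> * S - D * s)\<^sup>2 / (S * (S\<^sup>2 - x\<^sup>2 * s\<^sup>2)) \<le> (\<delta> * S - D * s)\<^sup>2 / (S * (S\<^sup>2 - s\<^sup>2))"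
    using S s2 xs by (intro divide_left_mono mult_left_mono mult_pos_pos) auto
  then have "x\<^sup>2 * ((\<delta> * S - D * s)\<^sup>2 / (S * (S\<^sup>2 - x\<^sup>2 * s\<^sup>2))) \<le> x\<^sup>2 * ((\<delta> * S - D * s)\<^sup>2 / (S * (S\<^sup>2 - s\<^sup>2)))"
    by (intro mult_left_mono) auto
  moreover have "d + y * r \<le> (1 - y) * d + y * (d + r')" if "y * r \<le> y * r'" for d y r r' :: real
    using that by (simp add: algebra_simps)
  moreover have "((D + \<delta>)\<^sup>2 / (S + s) + (D - \<delta>)\<^sup>2 / (S - s)) / 2
      = D\<^sup>2 / S + (\<delta> * S - D * s)\<^sup>2 / (S * (S\<^sup>2 - s\<^sup>2))"
    using E[of 1] by simp
  ultimately show ?thesis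
    unfolding E[OF assms(2)] by presburger
qed

text \<open>\<open>(u1, u2)\<close> and \<open>(v1, v2)\<close> are the likelihoods of the root spin jointly with a child spin \<open>+\<close>
  and \<open>-\<close>: observing the child through a symmetric channel of bias \<open>x\<close> is worth at most as much as
  observing it exactly with probability \<open>x\<^sup>2\<close>.\<close>

lemma chi_bsc_le_bec:
  fixes u1 u2 v1 v2 x :: real
  assumes "0 \<le> u1" "0 \<le> u2" "0 \<le> v1" "0 \<le> v2" "\<bar>x\<bar> \<le> 1"
  shows "(chi_kernel ((1 + x) * u1 + (1 - x) * v1) ((1 + x) * u2 + (1 - x) * v2)
       + chi_kernel ((1 - x) * u1 + (1 + x) * v1) ((1 - x) * u2 + (1 + x) * v2)) / 2
    \<le> (1 - x\<^sup>2) * chi_kernel (u1 + v1) (u2 + v2)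
       + x\<^sup>2 / 2 * (chi_kernel (2 * u1) (2 * u2) + chi_kernel (2 * v1) (2 * v2))"
proof -
  have x: "0 \<le> 1 + x" "0 \<le> 1 - x" using assms by auto
  have h: "chi_kernel (2 * u1) (2 * u2) = 2 * chi_kernel u1 u2"
     "chi_kernel (2 * v1) (2 * v2) = 2 * chi_kernel v1 v2" by (simp_all add: chi.hom)
  have c0: "chi_kernel 0 0 = 0" by (simp add: chi_kernel_def)
  \<comment> \<open>A child spin with likelihood 0 under both root spins would make
    \<open>\<bar>s\<bar> = S\<close>, and a denominator could vanish; homogeneity settles these
    cases directly.\<close>
  consider "u1 = 0 \<and> u2 = 0" | "v1 = 0 \<and> v2 = 0" | "u1 + u2 > 0" "v1 + v2 > 0"
    using assms by fastforce
  then show ?thesis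
  proof cases
    case 1
    then show ?thesis by (simp add: h chi.hom[OF x(1)] chi.hom[OF x(2)] c0) (simp add: field_simps)
  next
    case 2
    then show ?thesis by (simp add: h chi.hom[OF x(1)] chi.hom[OF x(2)] c0) (simp add: field_simps)
  next
    case 3
    define D \<delta> S s where "D = u1 - u2 + (v1 - v2)" and "\<delta> = u1 - u2 - (v1 - v2)"
      and "S = u1 + u2 + (v1 + v2)" and "s = u1 + u2 - (v1 + v2)"
    have k: "chi_kernel p q = d\<^sup>2 / (2 * e)" if "p - q = d" "p + q = e" for p q d e
      using that by (simp add: chi_kernel_def)
    have 4: "chi_kernel ((1 + x) * u1 + (1 - x) * v1) ((1 + x) * u2 + (1 - x) * v2) = (D + x * \<delta>)\<^sup>2 / (2 * (S + x * s))"
      "chi_kernel ((1 - x) * u1 + (1 + x) * v1) ((1 - x) * u2 + (1 + x) * v2) = (D - x * \<delta>)\<^sup>2 / (2 * (S - x * s))"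
      "chi_kernel (u1 + v1) (u2 + v2) = D\<^sup>2 / (2 * S)"
      "chi_kernel (2 * u1) (2 * u2) = (D + \<delta>)\<^sup>2 / (2 * (S + s))"
      "chi_kernel (2 * v1) (2 * v2) = (D - \<delta>)\<^sup>2 / (2 * (S - s))"
      by (rule k; simp add: D_def \<delta>_def S_def s_def algebra_simps)+
    have "\<bar>s\<bar> < S" using 3 by (auto simp: s_def S_def)
    from chi_bsc_le_bec_aux[OF this assms(5), of D \<delta>]
    have *: "((D + x * \<delta>)\<^sup>2 / (S + x * s) + (D - x * \<delta>)\<^sup>2 / (S - x * s)) / 2
      \<le> (1 - x\<^sup>2) * (D\<^sup>2 / S) + x\<^sup>2 * (((D + \<delta>)\<^sup>2 / (S + s) + (D - \<delta>)\<^sup>2 / (S - s)) / 2)" .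
    have half: "p / (2 * q) = p / q / 2" for p q :: real by simp
    have "(a / 2 + b / 2) / 2 \<le> (1 - y) * (c / 2) + y / 2 * (e / 2 + g / 2)"
      if "(a + b) / 2 \<le> (1 - y) * c + y * ((e + g) / 2)" for a b c e g y :: real
      using that by (simp add: field_simps)
    from this[OF *] show ?thesis unfolding 4 half .
  qed
qed

text \<open>The factor left over in \<open>quartic_chord\<close>, with \<open>c = w - 1\<close>. For
  \<open>c \<ge> 0\<close> regrouping makes all terms nonnegative. For \<open>c < 0\<close>, putting
  \<open>t = - c\<close> and \<open>z = t * l\<close> gives a quadratic in \<open>t\<close> with
  coefficients in \<open>z\<close>, and the square is completed.\<close>

lemma quartic_chord_polynomial:
  fixes c l :: real
  assumes "-1 \<le> c" "0 \<le> l" "l \<le> 1"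
  shows "0 \<le> 1 + 3 * c\<^sup>2 + (5 * c ^ 3 - 3 * c\<^sup>2) * l + (3 * c ^ 4 - c ^ 3) * l\<^sup>2" (is "0 \<le> ?q")
proof (cases "0 \<le> c")
  case True
  have "?q = 1 + 3 * c\<^sup>2 * (1 - l) + c ^ 3 * l * (5 - l) + 3 * c ^ 4 * l\<^sup>2" by algebra
  also have "\<dots> \<ge> 0" using assms True by (intro add_nonneg_nonneg mult_nonneg_nonneg) auto
  finally show ?thesis .
next
  case False
  define t z where "t = - c" and "z = - c * l"
  have z: "0 \<le> z" "z \<le> 1"
    using assms False mult_mono[of "- c" 1 l 1] by (auto simp: z_def mult_nonpos_nonneg)
  have disc: "3 - 5 * z + 3 * z\<^sup>2 > 0"
  proof -
    have "12 * (3 - 5 * z + 3 * z\<^sup>2) = (6 * z - 5)\<^sup>2 + 11" by algebra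
    then show ?thesis by (smt (verit) zero_le_power2)
  qed
  have "4 * (3 - 5 * z + 3 * z\<^sup>2) * ?q
      = (2 * (3 - 5 * z + 3 * z\<^sup>2) * t + (z\<^sup>2 - 3 * z))\<^sup>2 + (z - 1)\<^sup>2 * ((6 - z) * (z + 2))"
    unfolding t_def z_def by algebra
  also have "\<dots> \<ge> 0" using z by (intro add_nonneg_nonneg mult_nonneg_nonneg) auto
  finally show ?thesis using disc by (simp add: zero_le_mult_iff)
qed

text \<open>The left-hand side of the next lemma, divided by \<open>l\<^sup>2\<close>, is convex in \<open>l\<close>; the right-hand side
  is its chord. For \<open>l = 1\<close> subadditivity bounds the expectation, for \<open>l = 0\<close> a variance computation.
  The chord inequality is affine in \<open>((U - V) / 2)\<^sup>2\<close>, which leaves two extreme cases to check.\<close>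

lemma quartic_chord:
  fixes U V l :: real
  assumes "0 \<le> U" "0 \<le> V" "0 \<le> l" "l < 1"
  shows "quartic_kernel (1 - l + l * U) (1 - l + l * V)
      \<le> l\<^sup>2 * ((1 - l) * (U - V)\<^sup>2 / 4 + l * quartic_kernel U V)"
proof (cases "U + V = 0")
  case True
  then have "U = 0" "V = 0" using assms by auto
  then show ?thesis by (simp add: quartic_kernel_def chi_kernel_def)
next
  case False
  define w ov where "w = (U + V) / 2" and "ov = ((U - V) / 2)\<^sup>2"
  have w: "w > 0" using False assms by (simp add: w_def)
  define e where "e = 1 - l + l * w"
  have e: "e > 0" unfolding e_def using assms w by (simp add: add_pos_nonneg)
  have ov: "0 \<le> ov" "ov \<le> w\<^sup>2"
  proof -
    have "w\<^sup>2 - ov = U * V" by (simp add: w_def ov_def power2_eq_square field_simps)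
    then show "ov \<le> w\<^sup>2" using assms mult_nonneg_nonneg[of U V] by linarith
  qed (simp add: ov_def)
  have k: "quartic_kernel p q = y / r + y\<^sup>2 / (3 * r ^ 3)" if "p + q = 2 * r" "((p - q) / 2)\<^sup>2 = y" for p q r y
  proof -
    have "(p - q)\<^sup>2 = 4 * y" using that(2) by (simp add: power_divide)
    moreover from this have "(p - q) ^ 4 = 16 * y\<^sup>2"
      using power_mult[of "p - q" 2 2] by simp
    ultimately show ?thesis
      unfolding quartic_kernel_def chi_kernel_def that(1) by (simp add: power_mult_distrib)
  qed
  have 1: "quartic_kernel U V = ov / w + ov\<^sup>2 / (3 * w ^ 3)"
    by (rule k) (auto simp: w_def ov_def)
  have 2: "quartic_kernel (1 - l + l * U) (1 - l + l * V) = (l\<^sup>2 * ov) / e + (l\<^sup>2 * ov)\<^sup>2 / (3 * e ^ 3)"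
    by (rule k) (auto simp: w_def ov_def e_def field_simps power2_eq_square)
  have 3: "(1 - l) * (U - V)\<^sup>2 / 4 = (1 - l) * ov" by (simp add: ov_def power_divide)
  \<comment> \<open>The slack divided by \<open>l\<^sup>2 * ov\<close> is affine in
    \<open>ov\<close>: \<open>D0\<close> is its value at \<open>ov = 0\<close> and \<open>D1\<close>
    its value at \<open>ov = w\<^sup>2\<close>, the largest possible one because
    \<open>U * V \<ge> 0\<close>.\<close>
  have D0: "0 \<le> (1 - l) + l / w - 1 / e"
  proof -
    have "(1 - l) + l / w - 1 / e = l * (1 - l) * (w - 1)\<^sup>2 / (w * e)"
      using w e by (simp add: divide_simps) (simp add: e_def, algebra)
    then show ?thesis using assms w e by simp
  qed
  have D1: "0 \<le> (1 - l) + 4 * l / (3 * w) - 1 / e - l\<^sup>2 * w\<^sup>2 / (3 * e ^ 3)"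
  proof -
    let ?c = "w - 1"
    have "(1 - l) + 4 * l / (3 * w) - 1 / e - l\<^sup>2 * w\<^sup>2 / (3 * e ^ 3)
      = (3 * (1 - l) * w * e ^ 3 + 4 * l * e ^ 3 - 3 * w * e\<^sup>2 - l\<^sup>2 * w ^ 3) / (3 * w * e ^ 3)"
      using w e by (simp add: diff_divide_distrib add_divide_distrib power2_eq_square power3_eq_cube)
    also have "3 * (1 - l) * w * e ^ 3 + 4 * l * e ^ 3 - 3 * w * e\<^sup>2 - l\<^sup>2 * w ^ 3
      = l * (1 - l) * (1 + 3 * ?c\<^sup>2 + (5 * ?c ^ 3 - 3 * ?c\<^sup>2) * l + (3 * ?c ^ 4 - ?c ^ 3) * l\<^sup>2)"
    proof -
      have we: "w = 1 + ?c" "e = 1 + l * ?c" by (simp_all add: e_def algebra_simps)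
      show ?thesis unfolding we(2) by (subst (1 2 3) we(1)) algebra
    qed
    also have "\<dots> / (3 * w * e ^ 3) \<ge> 0"
      using assms w e quartic_chord_polynomial[of ?c l]
      by (intro divide_nonneg_nonneg mult_nonneg_nonneg) auto
    finally show ?thesis .
  qed
  have "ov / w\<^sup>2 * (l / (3 * w)) = l * ov / (3 * w ^ 3)"
    by (simp add: power2_eq_square power3_eq_cube ac_simps)
  moreover have "ov / w\<^sup>2 * (l\<^sup>2 * w\<^sup>2 / (3 * e ^ 3)) = l\<^sup>2 * ov / (3 * e ^ 3)"
    using w by simp
  moreover have "A + x - E + t * (x / 3) - t * R = (1 - t) * (A + x - E) + t * (A + 4 * x / 3 - E - R)"
    for A x E t R :: real
    by (simp add: field_simps)
  from this[of "1 - l" "l / w" "1 / e" "ov / w\<^sup>2" "l\<^sup>2 * w\<^sup>2 / (3 * e ^ 3)"]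
  have "1 - l + l / w - 1 / e + ov / w\<^sup>2 * (l / (3 * w)) - ov / w\<^sup>2 * (l\<^sup>2 * w\<^sup>2 / (3 * e ^ 3))
     = (1 - ov / w\<^sup>2) * ((1 - l) + l / w - 1 / e)
       + ov / w\<^sup>2 * ((1 - l) + 4 * l / (3 * w) - 1 / e - l\<^sup>2 * w\<^sup>2 / (3 * e ^ 3))"
    by (simp add: mult.commute)
  ultimately have "(1 - l) + l / w + l * ov / (3 * w ^ 3) - 1 / e - l\<^sup>2 * ov / (3 * e ^ 3)
     = (1 - ov / w\<^sup>2) * ((1 - l) + l / w - 1 / e)
       + ov / w\<^sup>2 * ((1 - l) + 4 * l / (3 * w) - 1 / e - l\<^sup>2 * w\<^sup>2 / (3 * e ^ 3))"
    by linarith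
  moreover have "ov / w\<^sup>2 \<le> 1" using w ov by (simp add: divide_simps)
  ultimately have "0 \<le> (1 - l) + l / w + l * ov / (3 * w ^ 3) - 1 / e - l\<^sup>2 * ov / (3 * e ^ 3)"
    using D0 D1 ov by (metis add_nonneg_nonneg diff_ge_0_iff_ge divide_nonneg_nonneg mult_nonneg_nonneg zero_le_power2)
  then have "0 \<le> l\<^sup>2 * ov * ((1 - l) + l / w + l * ov / (3 * w ^ 3) - 1 / e - l\<^sup>2 * ov / (3 * e ^ 3))"
    using ov by simp
  then show ?thesis
    unfolding 1 2 3 by (simp add: algebra_simps power2_eq_square)
qed

section \<open>One generation of the hypertree\<close>

lemma pmf_replicate_pmf:
  "pmf (replicate_pmf n p) xs = (if length xs = n then prod_list (map (pmf p) xs) else 0)"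
proof (induction n arbitrary: xs)
  case 0
  then show ?case by (auto simp: indicator_def)
next
  case (Suc n)
  show ?case
  proof (cases xs)
    case Nil
    then show ?thesis unfolding replicate_pmf_Suc_pair by (subst pmf_map_outside) auto
  next
    case (Cons y ys)
    have "pmf (replicate_pmf (Suc n) p) (y # ys) = pmf (pair_pmf p (replicate_pmf n p)) (y, ys)"
      unfolding replicate_pmf_Suc_pair
      using pmf_map_inj'[of "\<lambda>z. fst z # snd z" _ "(y, ys)"] by (auto simp: inj_def)
    then show ?thesis using Suc Cons by (simp add: pmf_pair)
  qed
qed

lemma map_replicate_pmf: "map_pmf (map f) (replicate_pmf n p) = replicate_pmf n (map_pmf f p)"
proof (induction n)
  case (Suc n)
  have "map_pmf (map f) (replicate_pmf (Suc n) p)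
      = map_pmf (\<lambda>z. fst z # snd z) (map_pmf (\<lambda>(x, xs). (f x, map f xs)) (pair_pmf p (replicate_pmf n p)))"
    unfolding replicate_pmf_Suc_pair by (simp add: map_pmf_comp case_prod_unfold)
  then show ?case unfolding replicate_pmf_Suc_pair map_pair Suc .
qed simp

lemma list_pmf_map_replicate: "list_pmf (map f (replicate n s)) = replicate_pmf n (f s)"
  by (induction n) auto

lemma bind_replicate_list_pmf:
  "bind_pmf (replicate_pmf n p) (\<lambda>xs. list_pmf (map f xs)) = replicate_pmf n (bind_pmf p f)"
proof (induction n)
  case (Suc n)
  have "bind_pmf (replicate_pmf (Suc n) p) (\<lambda>xs. list_pmf (map f xs))
     = p \<bind> (\<lambda>x. replicate_pmf n p \<bind> (\<lambda>xs. f x \<bind> (\<lambda>y. list_pmf (map f xs) \<bind> (\<lambda>ys. return_pmf (y # ys)))))"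
    by (simp add: bind_assoc_pmf bind_return_pmf)
  also have "\<dots> = p \<bind> (\<lambda>x. f x \<bind> (\<lambda>y. replicate_pmf n p \<bind> (\<lambda>xs. list_pmf (map f xs) \<bind> (\<lambda>ys. return_pmf (y # ys)))))"
    by (subst bind_commute_pmf) simp
  also have "\<dots> = replicate_pmf (Suc n) (bind_pmf p f)"
    by (simp add: Suc[symmetric] bind_assoc_pmf)
  finally show ?case .
qed (simp add: bind_return_pmf)

text \<open>With probability \<open>lam\<close> all children copy the parent, otherwise they are
  independent and uniform: this is \<open>B_kernel\<close> as a mixture. It replaces the sum over
  child labels by two product laws.\<close>

definition hyperedge :: "real \<Rightarrow> nat \<Rightarrow> (bool \<Rightarrow> 'a pmf) \<Rightarrow> bool \<Rightarrow> 'a list pmf" where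
  "hyperedge lam n P s = bind_pmf (bernoulli_pmf lam)
     (\<lambda>c. if c then replicate_pmf n (P s) else replicate_pmf n (mix P))"

lemma B_kernel_eq:
  assumes "0 \<le> lam" "lam \<le> 1"
  shows "B_kernel r lam y = bind_pmf (bernoulli_pmf lam)
    (\<lambda>c. if c then return_pmf (replicate (r - 1) y) else replicate_pmf (r - 1) (pmf_of_set UNIV))"
    (is "_ = ?M")
proof -
  have "(if length xs = r - 1 then
       (if (\<forall>x\<in>set xs. x = y) then lam + (1 - lam) / 2 ^ (r - 1) else (1 - lam) / 2 ^ (r - 1))
     else 0) = pmf ?M xs" for xs
  proof -
    have c: "(\<forall>x\<in>set xs. x = y) \<longleftrightarrow> xs = replicate (r - 1) y" if "length xs = r - 1"
    proof
      show "xs = replicate (r - 1) y" if "\<forall>x\<in>set xs. x = y"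
        using that \<open>length xs = r - 1\<close> by (auto intro: replicate_eqI)
      show "\<forall>x\<in>set xs. x = y" if h: "xs = replicate (r - 1) y"
        unfolding h by simp
    qed
    have u: "prod_list (map (pmf (pmf_of_set (UNIV :: bool set))) xs) = (1 / 2) ^ length xs"
    proof -
      have "pmf (pmf_of_set (UNIV :: bool set)) b = 1 / 2" for b
        by (subst pmf_of_set) (auto simp: UNIV_bool)
      then show ?thesis by (induction xs) simp_all
    qed
    have M: "pmf ?M xs = lam * pmf (return_pmf (replicate (r - 1) y)) xs
        + (1 - lam) * pmf (replicate_pmf (r - 1) (pmf_of_set UNIV)) xs"
      using assms by (simp add: pmf_bind)
    show ?thesis
    proof (cases "length xs = r - 1")
      case True
      then show ?thesis unfolding M pmf_replicate_pmf u c[OF True]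
        by (simp add: power_one_over)
    next
      case False
      then have "xs \<noteq> replicate (r - 1) y" by auto
      then show ?thesis unfolding M pmf_replicate_pmf using False by simp
    qed
  qed
  \<comment> \<open>\<open>embed_pmf\<close> inverts \<open>pmf\<close>, so agreement with the mass
    function of an actual pmf also settles that the weights are normalized.\<close>
  then have "B_kernel r lam y = embed_pmf (pmf ?M)"
    unfolding B_kernel_def by (intro arg_cong[of _ _ embed_pmf] ext)
  also have "\<dots> = ?M" by (rule type_definition.Rep_inverse[OF td_pmf_embed_pmf])
  finally show ?thesis .
qed

lemma bind_B_kernel:
  assumes "0 \<le> lam" "lam \<le> 1"
  shows "bind_pmf (B_kernel r lam s) (\<lambda>xs. list_pmf (map P xs)) = hyperedge lam (r - 1) P s"
proof -
  have "(if c then return_pmf (replicate (r - 1) s) else replicate_pmf (r - 1) (pmf_of_set UNIV))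
      \<bind> (\<lambda>xs. list_pmf (map P xs))
    = (if c then replicate_pmf (r - 1) (P s) else replicate_pmf (r - 1) (mix P))" for c
    by (simp only: bind_return_pmf list_pmf_map_replicate bind_replicate_list_pmf mix_def split: if_split)
       blast
  then show ?thesis
    unfolding B_kernel_eq[OF assms] hyperedge_def bind_assoc_pmf by presburger
qed

lemma obs_pmf_Suc:
  assumes "0 \<le> lam" "lam \<le> 1"
  shows "obs_pmf D r lam (Suc k) s
    = map_pmf Node (bind_pmf D (\<lambda>t. replicate_pmf t (hyperedge lam (r - 1) (obs_pmf D r lam k) s)))"
  unfolding obs_pmf.simps bind_B_kernel[OF assms] map_bind_pmf by (simp add: map_pmf_def)

section \<open>Invariance of the observation under the global spin flip\<close>

primrec flip :: "otree \<Rightarrow> otree" where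
  "flip (Leaf s) = Leaf (\<not> s)"
| "flip (Node hs) = Node (map (map flip) hs)"

lemma flip_flip: "flip (flip t) = t"
  by (induction t) (auto intro!: map_idI)

lemma inj_flip: "inj flip"
  by (metis flip_flip injI)

lemma hyperedge_flip:
  assumes "\<And>s. P (\<not> s) = map_pmf \<phi> (P s)"
  shows "hyperedge lam n P (\<not> s) = map_pmf (map \<phi>) (hyperedge lam n P s)"
  unfolding hyperedge_def map_bind_pmf
  by (intro bind_pmf_cong refl) (auto simp: map_replicate_pmf mix_flip[of P \<phi>, OF assms] assms)

lemma obs_pmf_flip:
  assumes "0 \<le> lam" "lam \<le> 1"
  shows "obs_pmf D r lam k (\<not> s) = map_pmf flip (obs_pmf D r lam k s)"
proof (induction k arbitrary: s)
  case 0
  then show ?case by simp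
next
  case (Suc k)
  show ?case
    unfolding obs_pmf_Suc[OF assms] hyperedge_flip[of "obs_pmf D r lam k" flip, OF Suc]
      map_replicate_pmf[symmetric] map_bind_pmf[symmetric]
    by (simp add: map_pmf_comp)
qed

lemma obs_pmf_symmetric:
  "0 \<le> lam \<Longrightarrow> lam \<le> 1 \<Longrightarrow> symmetric_channel (obs_pmf D r lam k)"
  by (rule symmetric_channelI[OF inj_flip]) (rule obs_pmf_flip)

lemma hyperedge_obs_symmetric:
  "0 \<le> lam \<Longrightarrow> lam \<le> 1 \<Longrightarrow> symmetric_channel (hyperedge lam n (obs_pmf D r lam k))"
  by (rule symmetric_channelI[of "map flip"]) (simp_all add: inj_flip hyperedge_flip[of "obs_pmf D r lam k" flip, OF obs_pmf_flip])

text \<open>For \<open>c = 1\<close> and \<open>c = -1\<close>, the likelihood of child observations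
  with biases \<open>xs\<close> when all children have that spin, relative to the product of
  mixtures.\<close>

definition tilt :: "real \<Rightarrow> real list \<Rightarrow> real" where
  "tilt c xs = prod_list (map (\<lambda>x. 1 + c * x) xs)"

lemma tilt_simps [simp]: "tilt c [] = 1" "tilt c (x # xs) = (1 + c * x) * tilt c xs"
  by (simp_all add: tilt_def)

lemma tilt_bounds:
  assumes "\<And>x. x \<in> set xs \<Longrightarrow> \<bar>x\<bar> \<le> 1" "\<bar>c\<bar> \<le> 1"
  shows "0 \<le> tilt c xs \<and> tilt c xs \<le> 2 ^ length xs"
  using assms(1)
proof (induction xs)
  case (Cons x xs)
  have "\<bar>c * x\<bar> \<le> 1" using abs_mult_le_1[OF assms(2)] Cons.prems by simp
  then have "0 \<le> 1 + c * x" "1 + c * x \<le> 2" by (auto simp: abs_le_iff)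
  moreover have "0 \<le> tilt c xs \<and> tilt c xs \<le> 2 ^ length xs" using Cons by simp
  ultimately show ?case by (auto intro!: mult_mono)
qed simp

lemma tilt_bounds_replicate:
  assumes "xs \<in> set_pmf (replicate_pmf m (law P))" "\<bar>c\<bar> \<le> 1"
  shows "0 \<le> tilt c xs \<and> tilt c xs \<le> 2 ^ m"
  using tilt_bounds[of xs c] assms law_abs[of _ P] by (auto simp: set_replicate_pmf)

context divergence_kernel
begin

lemma cap_obs_Suc:
  assumes "0 \<le> lam" "lam \<le> 1" "integrable (measure_pmf D) real"
  shows "cap F (obs_pmf D r lam (Suc k))
    \<le> measure_pmf.expectation D real * cap F (hyperedge lam (r - 1) (obs_pmf D r lam k))"
proof -
  have "cap F (obs_pmf D r lam (Suc k))
      = cap F (\<lambda>s. bind_pmf D (\<lambda>t. replicate_pmf t (hyperedge lam (r - 1) (obs_pmf D r lam k) s)))"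
    unfolding obs_pmf_Suc[OF assms(1,2), abs_def] by (rule cap_map_inj) (simp add: inj_def)
  also have "\<dots> \<le> measure_pmf.expectation D real * cap F (hyperedge lam (r - 1) (obs_pmf D r lam k))"
    by (rule cap_random_replicate[OF hyperedge_obs_symmetric[OF assms(1,2)] assms(3)])
  finally show ?thesis .
qed

lemma cap_hyperedge:
  assumes "0 \<le> lam" "lam \<le> 1"
  shows "cap F (hyperedge lam n P) = measure_pmf.expectation (replicate_pmf n (law P))
     (\<lambda>xs. F (1 - lam + lam * tilt 1 xs) (1 - lam + lam * tilt (- 1) xs))"
proof -
  have p: "prod_list (map (pmf (P s)) ys)
      = prod_list (map (pmf (mix P)) ys) * tilt (spin s) (map (bias P) ys)" for s ys
    by (induction ys) (auto simp: pmf_bias[of P s])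
  have "pmf (hyperedge lam n P s) ys
     = pmf (replicate_pmf n (mix P)) ys * (1 - lam + lam * tilt (spin s) (map (bias P) ys))" for s ys
    unfolding hyperedge_def using assms
    by (simp add: pmf_bind pmf_replicate_pmf p algebra_simps)
  from cap_density[OF this] show ?thesis
    unfolding law_def map_replicate_pmf[symmetric] by (simp add: spin_def)
qed

end

section \<open>Comparison with erasure channels\<close>

text \<open>For \<open>0 \<le> e \<le> 1\<close> the expectation of \<open>g (i + N)\<close>, where
  \<open>N\<close> is binomial with parameters \<open>n\<close> and \<open>e\<close>. The recursion
  decides for one child at a time whether it is revealed, as iterating \<open>bec\<close>
  does.\<close>

primrec bsum :: "(nat \<Rightarrow> real) \<Rightarrow> real \<Rightarrow> nat \<Rightarrow> nat \<Rightarrow> real" where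
  "bsum g e 0 i = g i"
| "bsum g e (Suc n) i = (1 - e) * bsum g e n i + e * bsum g e n (Suc i)"

text \<open>One further child observed through an erasure channel. The arguments \<open>a\<close>, \<open>b\<close> of \<open>W\<close> are the likelihoods of
  the children seen so far, given that all children copy a parent \<open>+\<close> or \<open>-\<close>, relative to uniform children.\<close>

definition bec :: "real \<Rightarrow> (real \<Rightarrow> real \<Rightarrow> real) \<Rightarrow> real \<Rightarrow> real \<Rightarrow> real" where
  "bec e W a b = (1 - e) * W a b + e / 2 * (W (2 * a) 0 + W 0 (2 * b))"

text \<open>Functions for which one child seen through a symmetric channel of bias \<open>x\<close>
  is worth at most that child erased with probability \<open>1 - x\<^sup>2\<close>. The growth bound
  secures integrability; children can be exchanged one by one because \<open>bec\<close> preserves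
  the class.\<close>

definition below_bec :: "(real \<Rightarrow> real \<Rightarrow> real) \<Rightarrow> bool" where
  "below_bec W \<longleftrightarrow>
     (\<exists>C\<ge>0. \<forall>a\<ge>0. \<forall>b\<ge>0. 0 \<le> W a b \<and> W a b \<le> C * (1 + a + b)) \<and>
     (\<forall>a\<ge>0. \<forall>b\<ge>0. \<forall>x. \<bar>x\<bar> \<le> 1 \<longrightarrow>
        (W (a * (1 + x)) (b * (1 - x)) + W (a * (1 - x)) (b * (1 + x))) / 2
          \<le> (1 - x\<^sup>2) * W a b + x\<^sup>2 / 2 * (W (2 * a) 0 + W 0 (2 * b)))"

lemma below_becD:
  assumes "below_bec W" "0 \<le> a" "0 \<le> b" "\<bar>x\<bar> \<le> 1"
  shows "(W (a * (1 + x)) (b * (1 - x)) + W (a * (1 - x)) (b * (1 + x))) / 2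
          \<le> (1 - x\<^sup>2) * W a b + x\<^sup>2 / 2 * (W (2 * a) 0 + W 0 (2 * b))"
  using assms unfolding below_bec_def by blast

text \<open>Operations on different children commute: the inequality for \<open>bec e W\<close> is
  the combination, with weights \<open>1 - e\<close>, \<open>e / 2\<close> and \<open>e / 2\<close>,
  of those for \<open>W\<close> at \<open>(a, b)\<close>, \<open>(2 * a, 0)\<close> and
  \<open>(0, 2 * b)\<close>.\<close>

lemma below_bec_bec:
  assumes W: "below_bec W" and e: "0 \<le> e" "e \<le> 1"
  shows "below_bec (bec e W)"
proof -
  obtain C where C: "0 \<le> C" "\<And>a b. 0 \<le> a \<Longrightarrow> 0 \<le> b \<Longrightarrow> 0 \<le> W a b \<and> W a b \<le> C * (1 + a + b)"
    using W unfolding below_bec_def by blast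
  have bnd: "0 \<le> bec e W a b \<and> bec e W a b \<le> 3 * C * (1 + a + b)" if ab: "0 \<le> a" "0 \<le> b" for a b
  proof
    have hyperedge_chi: "0 \<le> W a b" "0 \<le> W (2 * a) 0" "0 \<le> W 0 (2 * b)" using C(2)[of a b] C(2)[of "2 * a" 0] C(2)[of 0 "2 * b"] ab by auto
    then show "0 \<le> bec e W a b" unfolding bec_def using e by (intro add_nonneg_nonneg mult_nonneg_nonneg) auto
    have "bec e W a b \<le> 1 * W a b + 1 / 2 * (W (2 * a) 0 + W 0 (2 * b))"
      unfolding bec_def using e hyperedge_chi by (intro add_mono mult_right_mono) auto
    also have "\<dots> \<le> 1 * (C * (1 + a + b)) + 1 / 2 * (C * (1 + 2 * a + 0) + C * (1 + 0 + 2 * b))"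
      using C(2)[of a b] C(2)[of "2 * a" 0] C(2)[of 0 "2 * b"] ab by (intro add_mono mult_left_mono) auto
    also have "\<dots> = 2 * C * (1 + a + b)" by (simp add: field_simps)
    also have "\<dots> \<le> 3 * C * (1 + a + b)" using C(1) ab by (intro mult_right_mono) auto
    finally show "bec e W a b \<le> 3 * C * (1 + a + b)" .
  qed
  have "(bec e W (a * (1 + x)) (b * (1 - x)) + bec e W (a * (1 - x)) (b * (1 + x))) / 2
      \<le> (1 - x\<^sup>2) * bec e W a b + x\<^sup>2 / 2 * (bec e W (2 * a) 0 + bec e W 0 (2 * b))"
    if ab: "0 \<le> a" "0 \<le> b" "\<bar>x\<bar> \<le> 1" for a b x
  proof -
    \<comment> \<open>\<open>z\<close> is the value \<open>W 0 0\<close>, reached when two revealed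
      children disagree.\<close>
    have comb: "(c * p1 + f * (q1 + r1) + (c * p2 + f * (q2 + r2))) / 2
        \<le> k * (c * w + f * (w1 + w2)) + h * ((c * w1 + f * (z1 + z)) + (c * w2 + f * (z + z2)))"
      if "0 \<le> c" "0 \<le> f" "(p1 + p2) / 2 \<le> k * w + h * (w1 + w2)"
         "(q1 + q2) / 2 \<le> k * w1 + h * (z1 + z)"
         "(r1 + r2) / 2 \<le> k * w2 + h * (z + z2)" for p1 q1 r1 p2 q2 r2 c f k h w w1 w2 z1 z z2 :: real
    proof -
      have "(c * p1 + f * (q1 + r1) + (c * p2 + f * (q2 + r2))) / 2
          = c * ((p1 + p2) / 2) + f * ((q1 + q2) / 2 + (r1 + r2) / 2)"
        by (simp add: ring_distribs add_divide_distrib)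
      also have "\<dots> \<le> c * (k * w + h * (w1 + w2)) + f * ((k * w1 + h * (z1 + z)) + (k * w2 + h * (z + z2)))"
        using that by (intro add_mono mult_left_mono) auto
      also have "\<dots> = k * (c * w + f * (w1 + w2)) + h * ((c * w1 + f * (z1 + z)) + (c * w2 + f * (z + z2)))"
        by algebra
      finally show ?thesis .
    qed
    have e': "0 \<le> 1 - e" "0 \<le> e / 2" using e by auto
    have "0 \<le> 2 * a" "0 \<le> 2 * b" using ab by auto
    note * = below_becD[OF W ab] below_becD[OF W \<open>0 \<le> 2 * a\<close> order_refl ab(3)]
      below_becD[OF W order_refl \<open>0 \<le> 2 * b\<close> ab(3)]
    show ?thesis
      unfolding bec_def using comb[OF e' *[unfolded mult_zero_left mult_zero_right]]
      by (simp only: mult_zero_left mult_zero_right mult.assoc)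
  qed
  note split = this
  have "0 \<le> 3 * C" using C(1) by simp
  then show ?thesis
    unfolding below_bec_def
    by (intro conjI exI[of _ "3 * C"] allI impI) (simp, rule bnd[THEN conjunct1], assumption+,
      rule bnd[THEN conjunct2], assumption+, rule split, assumption+)
qed

lemma expectation_symmetric_affine:
  fixes \<alpha> \<beta> \<gamma> :: real
  assumes "symmetric_channel P"
  shows "measure_pmf.expectation (law P) (\<lambda>x. \<alpha> + \<beta> * x + \<gamma> * x\<^sup>2) = \<alpha> + \<gamma> * cap chi_kernel P"
proof -
  have i: "integrable (measure_pmf (law P)) (\<lambda>x. x)" "integrable (measure_pmf (law P)) (\<lambda>x. x\<^sup>2)"
    using law_abs[of _ P] by (auto intro!: integrable_pmf_bounded[where B=1] simp: abs_square_le_1)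
  have "measure_pmf.expectation (law P) (\<lambda>x. x) = 0"
    using expectation_symmetric[OF assms, of "\<lambda>x. x"] by simp
  then show ?thesis
    using i by (simp add: chi.cap_law chi_kernel_one_pm)
qed

text \<open>After averaging over \<open>x\<close> and \<open>- x\<close> the bound in
  \<open>below_bec\<close> is affine in \<open>x\<^sup>2\<close>, so only the second moment of the
  bias survives, and this is the chi-square capacity.\<close>

lemma below_bec_expectation:
  assumes W: "below_bec W" and ab: "0 \<le> a" "0 \<le> b" and P: "symmetric_channel P"
  shows "measure_pmf.expectation (law P) (\<lambda>x. W (a * (1 + x)) (b * (1 - x))) \<le> bec (cap chi_kernel P) W a b"
proof -
  let ?E = "measure_pmf.expectation (law P)"
  let ?G = "\<lambda>x. W (a * (1 + x)) (b * (1 - x))"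
  obtain C where C: "0 \<le> C" "\<And>a b. 0 \<le> a \<Longrightarrow> 0 \<le> b \<Longrightarrow> 0 \<le> W a b \<and> W a b \<le> C * (1 + a + b)"
    using W unfolding below_bec_def by blast
  have G: "\<bar>?G x\<bar> \<le> C * (1 + 2 * a + 2 * b)" if "\<bar>x\<bar> \<le> 1" for x
  proof -
    have *: "0 \<le> a * (1 + x)" "0 \<le> b * (1 - x)" "a * (1 + x) \<le> a * 2" "b * (1 - x) \<le> b * 2"
      using that ab by (auto simp: abs_le_iff intro!: mult_left_mono)
    then have "C * (1 + a * (1 + x) + b * (1 - x)) \<le> C * (1 + 2 * a + 2 * b)"
      using C(1) by (intro mult_left_mono) auto
    then show ?thesis using C(2)[OF *(1,2)] by linarith
  qed
  have iG: "integrable (measure_pmf (law P)) ?G" "integrable (measure_pmf (law P)) (\<lambda>x. ?G (- x))"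
    using G law_abs[of _ P] by (auto intro!: integrable_pmf_bounded[where B="C * (1 + 2 * a + 2 * b)"])
       (metis abs_minus_cancel diff_minus_eq_add add_uminus_conv_diff)
  have "?E (\<lambda>x. ?G (- x)) = ?E ?G" by (rule expectation_symmetric[OF P, of ?G])
  then have "?E ?G = (?E ?G + ?E (\<lambda>x. ?G (- x))) / 2" by simp
  also have "\<dots> = ?E (\<lambda>x. (?G x + ?G (- x)) / 2)"
    using iG by (subst integral_divide_zero, subst Bochner_Integration.integral_add) auto
  \<comment> \<open>The term \<open>0 * x\<close> gives the bound the shape of
    \<open>expectation_symmetric_affine\<close>.\<close>
  also have "\<dots> \<le> ?E (\<lambda>x. W a b + 0 * x + ((W (2 * a) 0 + W 0 (2 * b)) / 2 - W a b) * x\<^sup>2)"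
  proof (rule integral_mono_AE)
    show "integrable (measure_pmf (law P)) (\<lambda>x. (?G x + ?G (- x)) / 2)" using iG by simp
    have "integrable (measure_pmf (law P)) (\<lambda>x. x\<^sup>2)"
      using law_abs[of _ P] by (auto intro!: integrable_pmf_bounded[where B=1] simp: abs_square_le_1)
    then show "integrable (measure_pmf (law P))
       (\<lambda>x. W a b + 0 * x + ((W (2 * a) 0 + W 0 (2 * b)) / 2 - W a b) * x\<^sup>2)" by simp
    show "AE x in law P. (?G x + ?G (- x)) / 2
        \<le> W a b + 0 * x + ((W (2 * a) 0 + W 0 (2 * b)) / 2 - W a b) * x\<^sup>2"
    proof (rule AE_pmfI)
      fix x assume "x \<in> set_pmf (law P)"
      from below_becD[OF W ab law_abs[OF this]]
      have "(?G x + ?G (- x)) / 2 \<le> (1 - x\<^sup>2) * W a b + x\<^sup>2 / 2 * (W (2 * a) 0 + W 0 (2 * b))"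
        by simp
      also have "\<dots> = W a b + 0 * x + ((W (2 * a) 0 + W 0 (2 * b)) / 2 - W a b) * x\<^sup>2"
        by (simp add: field_simps)
      finally show "(?G x + ?G (- x)) / 2
        \<le> W a b + 0 * x + ((W (2 * a) 0 + W 0 (2 * b)) / 2 - W a b) * x\<^sup>2"
        .
    qed
  qed
  also have "\<dots> = bec (cap chi_kernel P) W a b"
    unfolding expectation_symmetric_affine[OF P] bec_def by (simp add: algebra_simps)
  finally show ?thesis .
qed

lemma chi_cap_bounds: "0 \<le> cap chi_kernel P" "cap chi_kernel P \<le> 1"
proof -
  show "cap chi_kernel P \<le> 1"
    unfolding chi.cap_law chi_kernel_one_pm using law_abs[of _ P]
    by (intro expectation_le_const[where B=1]) (auto simp: abs_square_le_1)
qed (use chi.cap_bounds in blast)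

lemma expectation_replicate_Suc:
  fixes f :: "'a list \<Rightarrow> real"
  assumes "\<And>xs. xs \<in> set_pmf (replicate_pmf (Suc n) p) \<Longrightarrow> 0 \<le> f xs \<and> f xs \<le> B"
  shows "measure_pmf.expectation (replicate_pmf (Suc n) p) f
    = measure_pmf.expectation (replicate_pmf n p) (\<lambda>xs. measure_pmf.expectation p (\<lambda>x. f (x # xs)))"
proof -
  have r: "replicate_pmf (Suc n) p = bind_pmf (replicate_pmf n p) (\<lambda>xs. map_pmf (\<lambda>x. x # xs) p)"
    by (simp add: map_pmf_def) (subst bind_commute_pmf, simp)
  show ?thesis
    unfolding r by (subst expectation_bind_pmf[where B=B]) (use assms[unfolded r] in auto)
qed

text \<open>Children are replaced by erasure channels one at a time. Each replacement turns
  \<open>W\<close> into \<open>bec e W\<close>, with \<open>e\<close> the chi-square capacity, hence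
  the induction over all \<open>W\<close> in the class.\<close>

lemma below_bec_expectation_replicate:
  assumes P: "symmetric_channel P" and "below_bec W" and ab: "0 \<le> a" "0 \<le> b"
  shows "measure_pmf.expectation (replicate_pmf n (law P)) (\<lambda>xs. W (a * tilt 1 xs) (b * tilt (- 1) xs))
     \<le> (bec (cap chi_kernel P) ^^ n) W a b"
  using assms(2)
proof (induction n arbitrary: W)
  case (Suc n)
  let ?e = "cap chi_kernel P"
  have tilt: "0 \<le> tilt 1 xs \<and> tilt 1 xs \<le> 2 ^ m" "0 \<le> tilt (- 1) xs \<and> tilt (- 1) xs \<le> 2 ^ m"
    if "xs \<in> set_pmf (replicate_pmf m (law P))" for xs m
    using tilt_bounds_replicate[OF that] by simp_all
  have bnd: "\<exists>B. \<forall>xs\<in>set_pmf (replicate_pmf m (law P)).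
      0 \<le> V (a * tilt 1 xs) (b * tilt (- 1) xs) \<and> V (a * tilt 1 xs) (b * tilt (- 1) xs) \<le> B" if "below_bec V" for V m
  proof -
    obtain C where C: "0 \<le> C" "\<And>a b. 0 \<le> a \<Longrightarrow> 0 \<le> b \<Longrightarrow> 0 \<le> V a b \<and> V a b \<le> C * (1 + a + b)"
      using \<open>below_bec V\<close> unfolding below_bec_def by blast
    have "0 \<le> V (a * tilt 1 xs) (b * tilt (- 1) xs) \<and> V (a * tilt 1 xs) (b * tilt (- 1) xs) \<le> C * (1 + a * 2 ^ m + b * 2 ^ m)"
      if "xs \<in> set_pmf (replicate_pmf m (law P))" for xs
    proof -
      have *: "0 \<le> a * tilt 1 xs" "0 \<le> b * tilt (- 1) xs" "a * tilt 1 xs \<le> a * 2 ^ m" "b * tilt (- 1) xs \<le> b * 2 ^ m"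
        using tilt[OF that] ab by (auto intro!: mult_left_mono)
      then have "C * (1 + a * tilt 1 xs + b * tilt (- 1) xs) \<le> C * (1 + a * 2 ^ m + b * 2 ^ m)"
        using C(1) by (intro mult_left_mono) auto
      then show ?thesis using C(2)[OF *(1,2)] by linarith
    qed
    then show ?thesis by blast
  qed
  have good: "below_bec (bec ?e W)" using below_bec_bec[OF Suc.prems] chi_cap_bounds by blast
  obtain B where B: "\<And>xs. xs \<in> set_pmf (replicate_pmf (Suc n) (law P)) \<Longrightarrow>
      0 \<le> W (a * tilt 1 xs) (b * tilt (- 1) xs) \<and> W (a * tilt 1 xs) (b * tilt (- 1) xs) \<le> B"
    using bnd[OF Suc.prems] by meson
  obtain B' where B': "\<And>xs. xs \<in> set_pmf (replicate_pmf n (law P)) \<Longrightarrow>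
      0 \<le> bec ?e W (a * tilt 1 xs) (b * tilt (- 1) xs) \<and> bec ?e W (a * tilt 1 xs) (b * tilt (- 1) xs) \<le> B'"
    using bnd[OF good] by meson
  have inner: "measure_pmf.expectation (law P) (\<lambda>x. W (a * tilt 1 (x # xs)) (b * tilt (- 1) (x # xs)))
      \<le> bec ?e W (a * tilt 1 xs) (b * tilt (- 1) xs)" if "xs \<in> set_pmf (replicate_pmf n (law P))" for xs
    using below_bec_expectation[OF Suc.prems _ _ P, of "a * tilt 1 xs" "b * tilt (- 1) xs"] tilt[OF that] ab
    by (simp add: mult.commute mult.left_commute)
  have "measure_pmf.expectation (replicate_pmf (Suc n) (law P)) (\<lambda>xs. W (a * tilt 1 xs) (b * tilt (- 1) xs))
    = measure_pmf.expectation (replicate_pmf n (law P))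
        (\<lambda>xs. measure_pmf.expectation (law P) (\<lambda>x. W (a * tilt 1 (x # xs)) (b * tilt (- 1) (x # xs))))"
    by (rule expectation_replicate_Suc[OF B])
  also have "\<dots> \<le> measure_pmf.expectation (replicate_pmf n (law P)) (\<lambda>xs. bec ?e W (a * tilt 1 xs) (b * tilt (- 1) xs))"
  proof (rule expectation_mono_pmf[OF inner, where B=B' and C=B'])
    fix xs assume xs: "xs \<in> set_pmf (replicate_pmf n (law P))"
    have "0 \<le> measure_pmf.expectation (law P) (\<lambda>x. W (a * tilt 1 (x # xs)) (b * tilt (- 1) (x # xs)))"
    proof (rule integral_nonneg_AE, rule AE_pmfI)
      fix x assume "x \<in> set_pmf (law P)"
      then have "x # xs \<in> set_pmf (replicate_pmf (Suc n) (law P))" using xs by (auto simp: set_replicate_pmf)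
      then show "0 \<le> W (a * tilt 1 (x # xs)) (b * tilt (- 1) (x # xs))" using B by blast
    qed
    then show "\<bar>measure_pmf.expectation (law P) (\<lambda>x. W (a * tilt 1 (x # xs)) (b * tilt (- 1) (x # xs)))\<bar> \<le> B'"
      using inner[OF xs] B'[OF xs] by linarith
    show "\<bar>bec ?e W (a * tilt 1 xs) (b * tilt (- 1) xs)\<bar> \<le> B'" using B'[OF xs] by linarith
  qed
  also have "\<dots> \<le> (bec ?e ^^ n) (bec ?e W) a b" by (rule Suc.IH[OF good])
  finally show ?case unfolding funpow_Suc_right o_apply .
qed simp

section \<open>Chi-square information of a hyperedge with erased children\<close>

definition hyperedge_chi :: "real \<Rightarrow> real \<Rightarrow> real \<Rightarrow> real" where
  "hyperedge_chi lam a b = chi_kernel (1 - lam + lam * a) (1 - lam + lam * b)"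

lemma below_bec_hyperedge_chi:
  assumes lam: "0 \<le> lam" "lam \<le> 1"
  shows "below_bec (hyperedge_chi lam)"
proof -
  have "0 \<le> hyperedge_chi lam a b \<and> hyperedge_chi lam a b \<le> 2 * (1 + a + b)" if "0 \<le> a" "0 \<le> b" for a b
  proof -
    have *: "0 \<le> 1 - lam + lam * a" "0 \<le> 1 - lam + lam * b" using lam that by auto
    moreover have "lam * a \<le> a" "lam * b \<le> b" using lam that by (auto simp: mult_left_le_one_le)
    ultimately have "(1 - lam + lam * a) + (1 - lam + lam * b) \<le> 3 * (1 + a + b)"
      using lam that by (simp add: algebra_simps)
    then have "2 / 3 * ((1 - lam + lam * a) + (1 - lam + lam * b)) \<le> 2 * (1 + a + b)" by simp
    then show ?thesis
      using chi.nonneg[OF *] order_trans[OF chi.bound[OF *]] unfolding hyperedge_chi_def by blast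
  qed
  moreover have "(hyperedge_chi lam (a * (1 + x)) (b * (1 - x)) + hyperedge_chi lam (a * (1 - x)) (b * (1 + x))) / 2
          \<le> (1 - x\<^sup>2) * hyperedge_chi lam a b + x\<^sup>2 / 2 * (hyperedge_chi lam (2 * a) 0 + hyperedge_chi lam 0 (2 * b))"
    if "0 \<le> a" "0 \<le> b" "\<bar>x\<bar> \<le> 1" for a b x
  proof -
    \<comment> \<open>The uniform branch is split evenly between the two spins of the next child, so
      that \<open>lam * a + h\<close>, \<open>h\<close> and \<open>h\<close>,
      \<open>lam * b + h\<close> are the joint likelihoods required by
      \<open>chi_bsc_le_bec\<close>.\<close>
    define h where "h = (1 - lam) / 2"
    then have h: "1 - lam = 2 * h" "0 \<le> h" using lam by auto
    have "2 * h + lam * (a * (1 + x)) = (1 + x) * (lam * a + h) + (1 - x) * h"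
      "2 * h + lam * (b * (1 - x)) = (1 + x) * h + (1 - x) * (lam * b + h)"
      "2 * h + lam * (a * (1 - x)) = (1 - x) * (lam * a + h) + (1 + x) * h"
      "2 * h + lam * (b * (1 + x)) = (1 - x) * h + (1 + x) * (lam * b + h)"
      "2 * h + lam * a = (lam * a + h) + h" "2 * h + lam * b = h + (lam * b + h)"
      "2 * h + lam * (2 * a) = 2 * (lam * a + h)" "2 * h + lam * (2 * b) = 2 * (lam * b + h)"
      "2 * h + lam * 0 = 2 * h"
      by algebra+
    note * = this
    show ?thesis unfolding hyperedge_chi_def h(1) * by (rule chi_bsc_le_bec) (use that lam h in auto)
  qed
  ultimately show ?thesis
    unfolding below_bec_def by (intro conjI exI[of _ 2]) auto
qed

text \<open>\<open>gain lam j\<close> is the chi-square information about the parent in \<open>j\<close> revealed children.\<close>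

definition gain :: "real \<Rightarrow> nat \<Rightarrow> real" where
  "gain lam j = (if j = 0 then 0 else lam\<^sup>2 / (lam + (1 - lam) * 2 powr (1 - real j)))"

text \<open>While all \<open>j > 0\<close> revealed children agree, the likelihoods are
  \<open>(2 ^ j, 0)\<close> or \<open>(0, 2 ^ j)\<close>; after a disagreement they are
  \<open>(0, 0)\<close>. Each agreeing pattern has probability \<open>1 / 2 ^ j\<close> under
  uniform children, whence the factor \<open>2 ^ j / 2\<close>.\<close>

lemma hyperedge_chi_values:
  "hyperedge_chi lam 1 1 = 0" "hyperedge_chi lam 0 0 = 0" "hyperedge_chi lam 0 a = hyperedge_chi lam a 0"
  "0 < j \<Longrightarrow> hyperedge_chi lam (2 ^ j) 0 = 2 ^ j / 2 * gain lam j"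
proof -
  show "hyperedge_chi lam 1 1 = 0" "hyperedge_chi lam 0 0 = 0" by (simp_all add: hyperedge_chi_def chi_kernel_def)
  show "hyperedge_chi lam 0 a = hyperedge_chi lam a 0" unfolding hyperedge_chi_def chi_kernel_def
    by (subst power2_commute) (simp only: add.commute)
  assume j: "0 < j"
  have p: "2 powr (1 - real j) = 2 / 2 ^ j" by (simp add: powr_diff powr_realpow)
  have "hyperedge_chi lam (2 ^ j) 0 = (lam * 2 ^ j)\<^sup>2 / (2 * (2 * (1 - lam) + lam * 2 ^ j))"
  proof -
    have "1 - lam + lam * 2 ^ j - (1 - lam + lam * 0) = lam * 2 ^ j"
      "1 - lam + lam * 2 ^ j + (1 - lam + lam * 0) = 2 * (1 - lam) + lam * 2 ^ j" by simp_all
    then show ?thesis by (simp only: hyperedge_chi_def chi_kernel_def)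
  qed
  also have "\<dots> = 2 ^ j / 2 * gain lam j"
  proof -
    have "lam + (1 - lam) * (2 / 2 ^ j) = (2 * (1 - lam) + lam * 2 ^ j) / 2 ^ j"
      by (simp add: add_divide_distrib)
    moreover have "(lam * t)\<^sup>2 / (2 * u) = t / 2 * (lam\<^sup>2 / (u / t))" for t u :: real
      by (simp add: power2_eq_square)
    ultimately show ?thesis using j by (simp only: gain_def p) simp
  qed
  finally show "hyperedge_chi lam (2 ^ j) 0 = 2 ^ j / 2 * gain lam j" .
qed

text \<open>Starting from \<open>(1, 1)\<close>, \<open>bec\<close> reaches the listed arguments and
  no others. The factor \<open>2 ^ j / 2\<close> doubles with every revealed child and cancels the
  \<open>1 / 2\<close> in \<open>bec\<close>, leaving the recursion of \<open>bsum\<close>.\<close>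

lemma bec_hyperedge_chi_values:
  "(bec e ^^ n) (hyperedge_chi lam) 0 0 = 0 \<and>
   (\<forall>j>0. (bec e ^^ n) (hyperedge_chi lam) (2 ^ j) 0 = 2 ^ j / 2 * bsum (gain lam) e n j) \<and>
   (\<forall>j>0. (bec e ^^ n) (hyperedge_chi lam) 0 (2 ^ j) = 2 ^ j / 2 * bsum (gain lam) e n j) \<and>
   (bec e ^^ n) (hyperedge_chi lam) 1 1 = bsum (gain lam) e n 0"
proof (induction n)
  case 0
  have "gain lam 0 = 0" by (simp add: gain_def)
  then show ?case by (simp add: hyperedge_chi_values(1,2,4) hyperedge_chi_values(3)[of lam "2 ^ j" for j])
next
  case (Suc n)
  let ?V = "(bec e ^^ n) (hyperedge_chi lam)"
  have S: "(bec e ^^ Suc n) (hyperedge_chi lam) a b = (1 - e) * ?V a b + e / 2 * (?V (2 * a) 0 + ?V 0 (2 * b))" for a b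
    by (simp add: bec_def)
  have 0: "?V 0 0 = 0" "?V 1 1 = bsum (gain lam) e n 0"
    and j: "0 < j \<Longrightarrow> ?V (2 ^ j) 0 = 2 ^ j / 2 * bsum (gain lam) e n j"
      "0 < j \<Longrightarrow> ?V 0 (2 ^ j) = 2 ^ j / 2 * bsum (gain lam) e n j" for j
    using Suc by blast+
  have 1: "?V (2 * 2 ^ j) 0 = 2 ^ j * bsum (gain lam) e n (Suc j)"
    "?V 0 (2 * 2 ^ j) = 2 ^ j * bsum (gain lam) e n (Suc j)" for j
    using j[of "Suc j"] by simp_all
  show ?case
  proof (intro conjI allI impI)
    show "(bec e ^^ Suc n) (hyperedge_chi lam) 0 0 = 0"
      unfolding S by (simp add: 0)
    show "(bec e ^^ Suc n) (hyperedge_chi lam) 1 1 = bsum (gain lam) e (Suc n) 0"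
      unfolding S using 0(2) 1[of 0] by simp
    fix i :: nat assume i: "0 < i"
    show "(bec e ^^ Suc n) (hyperedge_chi lam) (2 ^ i) 0 = 2 ^ i / 2 * bsum (gain lam) e (Suc n) i"
      unfolding S 1 j(1)[OF i] by (simp add: 0 field_simps)
    show "(bec e ^^ Suc n) (hyperedge_chi lam) 0 (2 ^ i) = 2 ^ i / 2 * bsum (gain lam) e (Suc n) i"
      unfolding S 1 j(2)[OF i] by (simp add: 0 field_simps)
  qed
qed

lemma chi_cap_hyperedge:
  assumes "0 \<le> lam" "lam \<le> 1" "symmetric_channel P"
  shows "cap chi_kernel (hyperedge lam n P) \<le> bsum (gain lam) (cap chi_kernel P) n 0"
  using below_bec_expectation_replicate[OF assms(3) below_bec_hyperedge_chi[OF assms(1,2)], of 1 1 n]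
    bec_hyperedge_chi_values[where e = "cap chi_kernel P" and n = n and lam = lam]
  by (simp add: chi.cap_hyperedge[OF assms(1,2)] hyperedge_chi_def)

section \<open>Mutual information\<close>

lemma chi_step:
  assumes "0 \<le> lam" "lam \<le> 1" "integrable (measure_pmf D) real"
  shows "cap chi_kernel (obs_pmf D r lam (Suc k))
    \<le> measure_pmf.expectation D real * bsum (gain lam) (cap chi_kernel (obs_pmf D r lam k)) (r - 1) 0"
proof -
  have "0 \<le> measure_pmf.expectation D real" by (intro integral_nonneg_AE AE_pmfI) simp
  from mult_left_mono[OF chi_cap_hyperedge[OF assms(1,2) obs_pmf_symmetric[OF assms(1,2)]] this]
  show ?thesis using chi.cap_obs_Suc[OF assms] by (rule order_trans[rotated])
qed

text \<open>Kullback-Leibler divergence is at most chi-square divergence: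
  \<open>ln t \<le> t - 1\<close> is applied to the density of the joint law relative to the product
  of its marginals.\<close>

lemma mutual_information_bounds:
  fixes P :: "bool \<Rightarrow> 'a :: countable pmf"
  defines "J \<equiv> bind_pmf (pmf_of_set (UNIV :: bool set)) (\<lambda>s. bind_pmf (P s) (\<lambda>t. return_pmf (s, t)))"
  defines "I \<equiv> prob_space.mutual_information (measure_pmf J) (exp 1) (count_space UNIV) (count_space UNIV) fst snd"
  shows "0 \<le> I" and "I \<le> cap chi_kernel P"
proof -
  let ?u = "pmf_of_set (UNIV :: bool set)"
  let ?CS = "count_space (UNIV :: (bool \<times> 'a) set)"
  let ?PU = "pair_pmf ?u (mix P)"
  let ?\<rho> = "\<lambda>z. 1 + spin (fst z) * bias P (snd z)"
  interpret sf: sigma_finite_measure ?CS by (rule sigma_finite_measure_count_space_countable) simp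
  have J': "J = bind_pmf ?u (\<lambda>s. map_pmf (Pair s) (P s))" by (simp add: J_def map_pmf_def)
  have u: "pmf ?u s = 1 / 2" for s by (subst pmf_of_set) (auto simp: UNIV_bool)
  have pJ: "pmf J (s, y) = pmf (P s) y / 2" for s y
  proof -
    have "pmf (map_pmf (Pair s') (P s')) (s, y) = (if s' = s then pmf (P s) y else 0)" for s'
    proof (cases "s' = s")
      case True
      then show ?thesis using pmf_map_inj'[of "Pair s" "P s" y] by (simp add: inj_def)
    next
      case False
      then show ?thesis by (subst pmf_map_outside) auto
    qed
    then show ?thesis unfolding J' pmf_bind
      by (subst integral_pmf_of_set) (auto simp: UNIV_bool)
  qed
  have pP: "pmf ?PU (s, y) = pmf (mix P) y / 2" for s y by (simp add: pmf_pair u)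
  have dens: "pmf J z = pmf ?PU z * ?\<rho> z" for z
    by (cases z) (simp add: pJ pP pmf_bias[of P])
  have fstJ: "map_pmf fst J = ?u"
    by (simp add: J' map_bind_pmf map_pmf_comp map_pmf_const bind_return_pmf')
  have sndJ: "map_pmf snd J = mix P"
    by (simp add: J' map_bind_pmf map_pmf_comp mix_def)
  have pair: "measure_pmf ?u \<Otimes>\<^sub>M measure_pmf (mix P) = density ?CS (\<lambda>z. ennreal (pmf ?PU z))"
  proof -
    have s1: "sigma_finite_measure (count_space (UNIV :: 'a set))"
      by (rule sigma_finite_measure_count_space_countable) simp
    have s2: "sigma_finite_measure (density (count_space UNIV) (\<lambda>y. ennreal (pmf (mix P) y)))"
      unfolding measure_pmf_eq_density[symmetric]
      by (rule prob_space_imp_sigma_finite[OF measure_pmf.prob_space_axioms])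
    have "measure_pmf ?u \<Otimes>\<^sub>M measure_pmf (mix P)
      = density (count_space UNIV \<Otimes>\<^sub>M count_space UNIV) (\<lambda>(x, y). ennreal (pmf ?u x) * ennreal (pmf (mix P) y))"
      unfolding measure_pmf_eq_density
      by (rule pair_measure_density[OF _ _ s1 s2]) auto
    also have "\<dots> = density ?CS (\<lambda>z. ennreal (pmf ?PU z))"
    proof -
      have "(\<lambda>(x, y). ennreal (pmf ?u x) * ennreal (pmf (mix P) y)) = (\<lambda>z. ennreal (pmf ?PU z))"
        by (intro ext, case_tac z) (simp only: pmf_pair ennreal_mult[OF pmf_nonneg pmf_nonneg] prod.case)
      then show ?thesis by (simp add: pair_measure_countable)
    qed
    finally show ?thesis .
  qed
  have I: "I = KL_divergence (exp 1) (density ?CS (\<lambda>z. ennreal (pmf ?PU z))) (density ?CS (\<lambda>z. ennreal (pmf J z)))"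
  proof -
    have "distr (measure_pmf J) (count_space UNIV) fst = measure_pmf ?u"
      "distr (measure_pmf J) (count_space UNIV) snd = measure_pmf (mix P)"
      unfolding fstJ[symmetric] sndJ[symmetric] by (simp_all add: map_pmf_rep_eq)
    moreover have "distr (measure_pmf J) (count_space UNIV \<Otimes>\<^sub>M count_space UNIV) (\<lambda>x. (fst x, snd x))
        = density ?CS (\<lambda>z. ennreal (pmf J z))"
    proof -
      have "distr (measure_pmf J) (count_space UNIV \<Otimes>\<^sub>M count_space UNIV) (\<lambda>x. (fst x, snd x))
         = distr (measure_pmf J) ?CS (\<lambda>x. x)"
        by (subst pair_measure_countable) auto
      also have "\<dots> = measure_pmf (map_pmf (\<lambda>x. x) J)" by (simp only: map_pmf_rep_eq)
      finally show ?thesis by (simp add: measure_pmf_eq_density)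
    qed
    ultimately show ?thesis
      unfolding I_def prob_space.mutual_information_def[OF measure_pmf.prob_space_axioms] pair[symmetric] by simp
  qed
  have e1: "(1 :: real) < exp 1" by simp
  have ac: "pmf ?PU z = 0 \<longrightarrow> pmf J z = 0" for z by (simp add: dens)
  let ?g = "\<lambda>z. pmf J z * log (exp 1) (pmf J z / pmf ?PU z)"
  have KL: "I = (\<integral>z. ?g z \<partial>?CS)"
    unfolding I by (rule sf.KL_density_density[OF e1]) (auto simp: ac)
  have g_le: "?g z \<le> pmf J z * (?\<rho> z - 1)" for z
  proof (cases "pmf J z = 0")
    case False
    then have "pmf ?PU z \<noteq> 0" "0 < ?\<rho> z"
      using dens[of z] pmf_nonneg[of J z] pmf_nonneg[of ?PU z] by (auto simp: zero_less_mult_iff order_le_less)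
    then have "log (exp 1) (pmf J z / pmf ?PU z) \<le> ?\<rho> z - 1"
      using ln_le_minus_one[of "?\<rho> z"] by (simp add: dens log_def)
    then show ?thesis by (intro mult_left_mono) auto
  qed simp
  show "0 \<le> I"
  \<comment> \<open>If \<open>?g\<close> were not integrable, its integral would be 0 by convention,
    which is compatible with both bounds.\<close>
  proof (cases "integrable ?CS ?g")
    case True
    show ?thesis unfolding I
      by (rule sf.KL_density_density_nonneg[OF e1])
         (auto simp: ac True simp flip: measure_pmf_eq_density intro: measure_pmf.prob_space_axioms)
  qed (simp add: KL not_integrable_integral_eq)
  show "I \<le> cap chi_kernel P"
  proof (cases "integrable ?CS ?g")
    case True
    have \<theta>: "\<bar>spin s * bias P y\<bar> \<le> 1" for s y using abs_bias_le[of P y] by (auto simp: spin_def)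
    have \<theta>2: "(bias P y)\<^sup>2 \<le> 1" for y using abs_bias_le[of P y] by (simp add: abs_square_le_1)
    \<comment> \<open>This is \<open>?\<rho> z * (?\<rho> z - 1)\<close> shifted by 1 to make it
      nonnegative, as \<open>expectation_bind_pmf\<close> requires; the part linear in the spin
      averages out.\<close>
    let ?h = "\<lambda>z. (1 + spin (fst z) * bias P (snd z)) + (bias P (snd z))\<^sup>2"
    have hb: "0 \<le> ?h z \<and> ?h z \<le> 3" for z
      using \<theta>[of "fst z" "snd z"] \<theta>2[of "snd z"] zero_le_power2[of "bias P (snd z)"]
      by (auto simp: abs_le_iff)
    have i2: "integrable (measure_pmf (mix P)) (\<lambda>y. (bias P y)\<^sup>2)"
      "integrable (measure_pmf (mix P)) (bias P)"
      using \<theta>2 abs_bias_le[of P] by (auto intro!: integrable_pmf_bounded[where B=1])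
    have "measure_pmf.expectation ?PU ?h
        = measure_pmf.expectation ?u (\<lambda>s. measure_pmf.expectation (mix P) (\<lambda>y. ?h (s, y)))"
      unfolding pair_pmf_def by (subst expectation_bind_pmf[where B=3]) (use hb in \<open>auto simp: map_pmf_def[symmetric]\<close>)
    also have "\<dots> = 1 + measure_pmf.expectation (mix P) (\<lambda>y. (bias P y)\<^sup>2)"
      using i2 by (subst integral_pmf_of_set) (auto simp: UNIV_bool spin_def)
    finally have E: "measure_pmf.expectation ?PU ?h = 1 + cap chi_kernel P"
      by (simp add: chi.cap_law expectation_law chi_kernel_one_pm)
    have "I \<le> (\<integral>z. pmf J z * (?\<rho> z - 1) \<partial>?CS)"
      unfolding KL
    proof (rule integral_mono[OF True _ g_le])
      have "integrable (measure_pmf J) (\<lambda>z. ?\<rho> z - 1)"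
        using \<theta> by (auto intro!: integrable_pmf_bounded[where B=1])
      then show "integrable ?CS (\<lambda>z. pmf J z * (?\<rho> z - 1))"
        unfolding measure_pmf_eq_density by (subst (asm) integrable_density) auto
    qed
    also have "\<dots> = (\<integral>z. pmf ?PU z * (?h z - 1) \<partial>?CS)"
    proof (rule Bochner_Integration.integral_cong[OF refl])
      fix z :: "bool \<times> 'a"
      have "(spin (fst z))\<^sup>2 = 1" by (simp add: spin_def)
      then have "?\<rho> z * (?\<rho> z - 1) = ?h z - 1" by (simp add: algebra_simps power2_eq_square)
      then show "pmf J z * (?\<rho> z - 1) = pmf ?PU z * (?h z - 1)"
        unfolding dens by (simp only: mult.assoc)
    qed
    also have "\<dots> = measure_pmf.expectation ?PU (\<lambda>z. ?h z - 1)" by (simp add: expectation_density)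
    also have "\<dots> = measure_pmf.expectation ?PU ?h - 1"
      by (subst Bochner_Integration.integral_diff)
         (use hb in \<open>auto intro!: integrable_pmf_bounded[where B=3]\<close>)
    finally show ?thesis unfolding E by simp
  next
    case False
    then show ?thesis using chi_cap_bounds(1)[of P] by (simp add: KL not_integrable_integral_eq)
  qed
qed

lemma BOHT_MI_bounds:
  "0 \<le> BOHT_MI D r lam k" "BOHT_MI D r lam k \<le> cap chi_kernel (obs_pmf D r lam k)"
  using mutual_information_bounds[of "obs_pmf D r lam k"]
  by (simp_all add: BOHT_MI_def BOHT_joint_def)

lemma reconstruction_impossibleI:
  assumes "(\<lambda>k. cap chi_kernel (obs_pmf D r lam k)) \<longlonglongrightarrow> 0"
  shows "reconstruction_impossible D r lam"
  unfolding reconstruction_impossible_def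
  by (rule tendsto_sandwich[OF _ _ tendsto_const assms]) (auto intro!: always_eventually BOHT_MI_bounds)

section \<open>Quadratic decrease\<close>

lemma bsum_closed_form:
  "bsum g e n i = (\<Sum>j\<le>n. real (n choose j) * (1 - e) ^ (n - j) * e ^ j * g (i + j))"
proof (induction n arbitrary: i)
  case (Suc n)
  let ?t = "\<lambda>c m j k. real c * (1 - e) ^ m * e ^ k * g (i + j)"
  have "(\<Sum>j\<le>Suc n. ?t (Suc n choose j) (Suc n - j) j j)
    = ?t 1 (Suc n) 0 0 + (\<Sum>j\<le>n. ?t (n choose Suc j) (n - j) (Suc j) (Suc j)) + (\<Sum>j\<le>n. ?t (n choose j) (n - j) (Suc j) (Suc j))"
    by (subst sum.atMost_Suc_shift) (simp add: sum.distrib algebra_simps)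
  also have "?t 1 (Suc n) 0 0 + (\<Sum>j\<le>n. ?t (n choose Suc j) (n - j) (Suc j) (Suc j))
      = (\<Sum>j\<le>Suc n. ?t (n choose j) (Suc n - j) j j)"
    by (subst sum.atMost_Suc_shift) simp
  also have "\<dots> = (\<Sum>j\<le>n. ?t (n choose j) (Suc n - j) j j)" by (simp add: sum.atMost_Suc)
  also have "\<dots> = (1 - e) * (\<Sum>j\<le>n. ?t (n choose j) (n - j) j j)"
    unfolding sum_distrib_left by (intro sum.cong refl) (simp add: Suc_diff_le)
  also have "(\<Sum>j\<le>n. ?t (n choose j) (n - j) (Suc j) (Suc j))
      = e * (\<Sum>j\<le>n. real (n choose j) * (1 - e) ^ (n - j) * e ^ j * g (Suc i + j))"
    unfolding sum_distrib_left by (intro sum.cong refl) simp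
  finally show ?case by (simp add: Suc)
qed simp

text \<open>The term without revealed children vanishes since \<open>gain lam 0 = 0\<close>, so a
  factor \<open>e\<close> can be taken out; what remains is the function of part (ii), up to
  normalization.\<close>

lemma bsum_gain_f_rl:
  assumes "r \<ge> 2"
  shows "bsum (gain lam) e (r - 1) 0 = e * ((real r - 1) * f_rl r lam e)"
proof -
  define n where "n = r - 1"
  have n: "real r - 1 = real n" "n > 0" using assms by (auto simp: n_def)
  have "bsum (gain lam) e n 0 = (\<Sum>j=1..n. real (n choose j) * (1 - e) ^ (n - j) * e ^ j * gain lam j)"
  proof -
    have "{..n} = insert 0 {1..n}" by auto
    then show ?thesis by (simp add: bsum_closed_form gain_def)
  qed
  also have "\<dots> = e * (\<Sum>j=1..n. real (n choose j) * (1 - e) ^ (n - j) * e ^ (j - 1)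
      * (lam\<^sup>2 / (lam + (1 - lam) * 2 powr (1 - real j))))"
    unfolding sum_distrib_left
  proof (intro sum.cong refl)
    fix j assume "j \<in> {1..n}"
    then have "j \<noteq> 0" "e ^ j = e * e ^ (j - 1)" by (auto simp: power_eq_if)
    then show "real (n choose j) * (1 - e) ^ (n - j) * e ^ j * gain lam j
      = e * (real (n choose j) * (1 - e) ^ (n - j) * e ^ (j - 1) * (lam\<^sup>2 / (lam + (1 - lam) * 2 powr (1 - real j))))"
      by (simp add: gain_def)
  qed
  also have "\<dots> = e * ((real r - 1) * f_rl r lam e)"
    unfolding f_rl_def n_def[symmetric] n(1) using n(2) by simp
  finally show ?thesis by (simp add: n_def)
qed

text \<open>The right side is the binomial expectation of the quadratic bound, given by the first
  two factorial moments of \<open>i + N\<close>. At \<open>i = 0\<close> and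
  \<open>\<delta> > 0\<close> it contains a loss of order \<open>e\<^sup>2\<close>, which replaces
  strict contraction at the threshold.\<close>

lemma bsum_quadratic_bound:
  assumes "0 \<le> e" "e \<le> 1"
    and "\<And>j. j \<le> i + n \<Longrightarrow> g j \<le> a * real j - \<delta> * (real j * (real j - 1))"
  shows "bsum g e n i \<le> a * (real i + real n * e)
     - \<delta> * (real i * (real i - 1) + 2 * real i * real n * e + real n * (real n - 1) * e\<^sup>2)"
  using assms(3)
proof (induction n arbitrary: i)
  case 0
  then show ?case by simp
next
  case (Suc n)
  let ?Q = "\<lambda>m i. a * (real i + real m * e)
     - \<delta> * (real i * (real i - 1) + 2 * real i * real m * e + real m * (real m - 1) * e\<^sup>2)"
  have "(1 - e) * bsum g e n i \<le> (1 - e) * ?Q n i"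
    using assms Suc.prems by (intro mult_left_mono Suc.IH) auto
  moreover have "e * bsum g e n (Suc i) \<le> e * ?Q n (Suc i)"
    using assms Suc.prems by (intro mult_left_mono Suc.IH) auto
  moreover have "(1 - e) * ?Q n i + e * ?Q n (Suc i) = ?Q (Suc n) i"
    unfolding of_nat_Suc by algebra
  ultimately show ?case by (simp only: bsum.simps)
qed

text \<open>A decreasing nonnegative sequence has decrements tending to 0, and these dominate the
  squares of \<open>x\<close>. Keeping \<open>s\<close> apart from \<open>x\<close> permits a
  different Lyapunov sequence, as for \<open>r = 4\<close>.\<close>

lemma tendsto_zero_of_square_bound:
  fixes x s :: "nat \<Rightarrow> real"
  assumes "0 < c" "\<And>k. 0 \<le> s k" "\<And>k. s (Suc k) \<le> s k"
    and x: "\<And>k. 0 \<le> x k" "eventually (\<lambda>k. c * (x k)\<^sup>2 \<le> s k - s (Suc k)) sequentially"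
  shows "x \<longlonglongrightarrow> 0"
proof -
  have "decseq s" using assms(3) by (rule decseq_SucI)
  then obtain L where L: "s \<longlonglongrightarrow> L" using decseq_convergent[of s 0] assms(2) by blast
  have "(\<lambda>k. (s k - s (Suc k)) / c) \<longlonglongrightarrow> (L - L) / c"
    using L LIMSEQ_Suc[OF L] assms(1) by (intro tendsto_intros) auto
  then have lim: "(\<lambda>k. (s k - s (Suc k)) / c) \<longlonglongrightarrow> 0" by simp
  have "(\<lambda>k. (x k)\<^sup>2) \<longlonglongrightarrow> 0"
  proof (rule tendsto_sandwich[OF _ _ tendsto_const lim])
    show "eventually (\<lambda>k. (x k)\<^sup>2 \<le> (s k - s (Suc k)) / c) sequentially"
      using x(2) by eventually_elim (use assms(1) in \<open>simp add: field_simps\<close>)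
  qed simp
  then have "(\<lambda>k. sqrt ((x k)\<^sup>2)) \<longlonglongrightarrow> sqrt 0" by (intro tendsto_real_sqrt)
  then show ?thesis using x(1) by simp
qed

lemma tendsto_zero_of_Suc_nonpos:
  fixes x :: "nat \<Rightarrow> real"
  assumes "\<And>k. 0 \<le> x k" "\<And>k. x (Suc k) \<le> 0"
  shows "x \<longlonglongrightarrow> 0"
proof -
  have "x (Suc k) = 0" for k using assms(1)[of "Suc k"] assms(2)[of k] by linarith
  then have "(\<lambda>k. x (Suc k)) \<longlonglongrightarrow> 0" by simp
  then show ?thesis by (rule LIMSEQ_imp_Suc)
qed

text \<open>One more child of bias \<open>x\<close> adds \<open>x\<close> times the sum of the tilts
  to their difference, and \<open>x\<close> times the difference to their sum; symmetry removes the
  cross terms. Three steps give the \<open>lam = 0\<close> end of the quartic chord.\<close>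

lemma expectation_tilt_squares:
  assumes P: "symmetric_channel P"
  defines "X \<equiv> cap chi_kernel P"
  defines "A \<equiv> \<lambda>n. measure_pmf.expectation (replicate_pmf n (law P)) (\<lambda>xs. (tilt 1 xs - tilt (- 1) xs)\<^sup>2)"
    and "B \<equiv> \<lambda>n. measure_pmf.expectation (replicate_pmf n (law P)) (\<lambda>xs. (tilt 1 xs + tilt (- 1) xs)\<^sup>2)"
  shows "A 0 = 0" "B 0 = 4" "A (Suc n) = A n + X * B n" "B (Suc n) = B n + X * A n"
proof -
  show "A 0 = 0" "B 0 = 4" by (simp_all add: A_def B_def)
  have bd: "0 \<le> (tilt 1 xs - tilt (- 1) xs)\<^sup>2 \<and> (tilt 1 xs - tilt (- 1) xs)\<^sup>2 \<le> 4 * 4 ^ m"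
     "0 \<le> (tilt 1 xs + tilt (- 1) xs)\<^sup>2 \<and> (tilt 1 xs + tilt (- 1) xs)\<^sup>2 \<le> 4 * 4 ^ m"
    if "xs \<in> set_pmf (replicate_pmf m (law P))" for xs m
  proof -
    have "0 \<le> tilt 1 xs \<and> tilt 1 xs \<le> 2 ^ m" "0 \<le> tilt (- 1) xs \<and> tilt (- 1) xs \<le> 2 ^ m"
      using tilt_bounds_replicate[OF that] by simp_all
    then have "\<bar>tilt 1 xs - tilt (- 1) xs\<bar> \<le> 2 * 2 ^ m" "\<bar>tilt 1 xs + tilt (- 1) xs\<bar> \<le> 2 * 2 ^ m" by auto
    moreover have "y\<^sup>2 \<le> 4 * 4 ^ m" if "\<bar>y\<bar> \<le> 2 * 2 ^ m" for y :: real
    proof -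
      have "(4 :: real) * 4 ^ m = (2 * 2 ^ m)\<^sup>2"
        by (simp add: power2_eq_square flip: power_mult_distrib)
      then show ?thesis using abs_le_square_iff[of y "2 * 2 ^ m"] that by simp
    qed
    ultimately show "0 \<le> (tilt 1 xs - tilt (- 1) xs)\<^sup>2 \<and> (tilt 1 xs - tilt (- 1) xs)\<^sup>2 \<le> 4 * 4 ^ m"
      "0 \<le> (tilt 1 xs + tilt (- 1) xs)\<^sup>2 \<and> (tilt 1 xs + tilt (- 1) xs)\<^sup>2 \<le> 4 * 4 ^ m"
      by simp_all
  qed
  have iA: "integrable (measure_pmf (replicate_pmf n (law P))) (\<lambda>xs. (tilt 1 xs - tilt (- 1) xs)\<^sup>2)"
    and iB: "integrable (measure_pmf (replicate_pmf n (law P))) (\<lambda>xs. (tilt 1 xs + tilt (- 1) xs)\<^sup>2)"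
    using bd by (auto intro!: integrable_pmf_bounded[where B="4 * 4 ^ n"])
  have step: "measure_pmf.expectation (law P) (\<lambda>x. (\<alpha> + \<beta> * x)\<^sup>2) = \<alpha>\<^sup>2 + X * \<beta>\<^sup>2" for \<alpha> \<beta>
  proof -
    have "(\<lambda>x. (\<alpha> + \<beta> * x)\<^sup>2) = (\<lambda>x. \<alpha>\<^sup>2 + (2 * \<alpha> * \<beta>) * x + \<beta>\<^sup>2 * x\<^sup>2)"
      by (rule ext) algebra
    then show ?thesis
      using expectation_symmetric_affine[OF P, of "\<alpha>\<^sup>2" "2 * \<alpha> * \<beta>" "\<beta>\<^sup>2"]
      by (simp only: X_def mult.commute[of "cap chi_kernel P"])
  qed
  have "A (Suc n) = measure_pmf.expectation (replicate_pmf n (law P))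
      (\<lambda>xs. measure_pmf.expectation (law P) (\<lambda>x. (tilt 1 (x # xs) - tilt (- 1) (x # xs))\<^sup>2))"
    unfolding A_def by (rule expectation_replicate_Suc[OF bd(1)])
  also have "\<dots> = measure_pmf.expectation (replicate_pmf n (law P))
      (\<lambda>xs. measure_pmf.expectation (law P) (\<lambda>x. ((tilt 1 xs - tilt (- 1) xs) + (tilt 1 xs + tilt (- 1) xs) * x)\<^sup>2))"
    by (simp add: algebra_simps)
  also have "\<dots> = A n + X * B n"
    unfolding step A_def B_def using iA iB by simp
  finally show "A (Suc n) = A n + X * B n" .
  have "B (Suc n) = measure_pmf.expectation (replicate_pmf n (law P))
      (\<lambda>xs. measure_pmf.expectation (law P) (\<lambda>x. (tilt 1 (x # xs) + tilt (- 1) (x # xs))\<^sup>2))"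
    unfolding B_def by (rule expectation_replicate_Suc[OF bd(2)])
  also have "\<dots> = measure_pmf.expectation (replicate_pmf n (law P))
      (\<lambda>xs. measure_pmf.expectation (law P) (\<lambda>x. ((tilt 1 xs + tilt (- 1) xs) + (tilt 1 xs - tilt (- 1) xs) * x)\<^sup>2))"
    by (simp add: algebra_simps)
  also have "\<dots> = B n + X * A n"
    unfolding step A_def B_def using iA iB by simp
  finally show "B (Suc n) = B n + X * A n" .
qed

text \<open>Integrates the chord inequality. At the end \<open>lam = 1\<close> the hyperedge is
  three copies of \<open>P\<close>, with capacity at most three times that of \<open>P\<close> and
  also at most 4/3; the second bound later forces a decrease while the capacity is large.\<close>

lemma quartic_cap_hyperedge:
  assumes lam: "0 \<le> lam" "lam < 1" and P: "symmetric_channel P"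
  shows "cap quartic_kernel (hyperedge lam 3 P)
    \<le> lam\<^sup>2 * ((1 - lam) * (3 * cap chi_kernel P + (cap chi_kernel P) ^ 3)
        + lam * min (3 * cap quartic_kernel P) (4 / 3))"
proof -
  let ?X = "cap chi_kernel P"
  let ?L = "replicate_pmf 3 (law P)"
  let ?A = "\<lambda>xs. (tilt 1 xs - tilt (- 1) xs)\<^sup>2" and ?K = "\<lambda>xs. quartic_kernel (tilt 1 xs) (tilt (- 1) xs)"
  have tilt: "0 \<le> tilt 1 xs" "tilt 1 xs \<le> 8" "0 \<le> tilt (- 1) xs" "tilt (- 1) xs \<le> 8" if "xs \<in> set_pmf ?L" for xs
    using tilt_bounds_replicate[OF that, of 1] tilt_bounds_replicate[OF that, of "- 1"] by simp_all
  have "\<bar>?A xs\<bar> \<le> 64" if "xs \<in> set_pmf ?L" for xs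
  proof -
    have "\<bar>tilt 1 xs - tilt (- 1) xs\<bar> \<le> \<bar>8\<bar>" using tilt[OF that] by auto
    then have "?A xs \<le> 8\<^sup>2" by (simp only: abs_le_square_iff)
    then show ?thesis by simp
  qed
  then have iA: "integrable (measure_pmf ?L) ?A" by (rule integrable_pmf_bounded)
  have iK: "integrable (measure_pmf ?L) ?K"
  proof (rule integrable_pmf_bounded)
    fix xs assume "xs \<in> set_pmf ?L"
    note b = tilt[OF this]
    have "2 / 3 * (tilt 1 xs + tilt (- 1) xs) \<le> 32 / 3" using b by simp
    then have "?K xs \<le> 32 / 3" using quartic.bound[OF b(1,3)] by linarith
    then show "\<bar>?K xs\<bar> \<le> 32 / 3" using quartic.nonneg[OF b(1,3)] by simp
  qed
  have h1: "hyperedge 1 3 P = (\<lambda>s. replicate_pmf 3 (P s))"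
  proof
    have "bernoulli_pmf 1 = return_pmf True"
      by (rule pmf_eqI) (auto simp: indicator_def split: bool.split)
    then show "hyperedge 1 3 P s = replicate_pmf 3 (P s)" for s
      by (simp add: hyperedge_def bind_return_pmf)
  qed
  have K: "measure_pmf.expectation ?L ?K = cap quartic_kernel (\<lambda>s. replicate_pmf 3 (P s))"
    using quartic.cap_hyperedge[of 1 3 P] unfolding h1 by simp
  have A: "measure_pmf.expectation ?L ?A = 4 * (3 * ?X + ?X ^ 3)"
  proof -
    note s = expectation_tilt_squares[OF P]
    have "measure_pmf.expectation (replicate_pmf (Suc (Suc (Suc 0))) (law P)) ?A = 4 * (3 * ?X + ?X ^ 3)"
      unfolding s by (simp add: algebra_simps power3_eq_cube)
    then show ?thesis by (simp only: numeral_3_eq_3)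
  qed
  have "cap quartic_kernel (hyperedge lam 3 P)
      \<le> measure_pmf.expectation ?L (\<lambda>xs. lam\<^sup>2 * ((1 - lam) * ?A xs / 4 + lam * ?K xs))"
    unfolding quartic.cap_hyperedge[OF lam(1) less_imp_le[OF lam(2)]]
  proof (rule integral_mono_AE)
    show "integrable (measure_pmf ?L)
       (\<lambda>xs. quartic_kernel (1 - lam + lam * tilt 1 xs) (1 - lam + lam * tilt (- 1) xs))"
    proof (rule integrable_pmf_bounded)
      fix xs assume "xs \<in> set_pmf ?L"
      note b = tilt[OF this]
      have c: "lam * tilt 1 xs \<le> 1 * 8" "lam * tilt (- 1) xs \<le> 1 * 8"
        using lam b by (intro mult_mono; simp)+
      have d: "0 \<le> 1 - lam + lam * tilt 1 xs" "0 \<le> 1 - lam + lam * tilt (- 1) xs" using lam b by auto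
      show "\<bar>quartic_kernel (1 - lam + lam * tilt 1 xs) (1 - lam + lam * tilt (- 1) xs)\<bar> \<le> 18"
        using quartic.nonneg[OF d] quartic.bound[OF d] c lam by (simp add: abs_le_iff)
    qed
    show "integrable (measure_pmf ?L) (\<lambda>xs. lam\<^sup>2 * ((1 - lam) * ?A xs / 4 + lam * ?K xs))"
      using iA iK by simp
    show "AE xs in ?L. quartic_kernel (1 - lam + lam * tilt 1 xs) (1 - lam + lam * tilt (- 1) xs)
       \<le> lam\<^sup>2 * ((1 - lam) * ?A xs / 4 + lam * ?K xs)"
      using tilt lam by (intro AE_pmfI quartic_chord) auto
  qed
  also have "\<dots> = lam\<^sup>2 * ((1 - lam) * measure_pmf.expectation ?L ?A / 4 + lam * measure_pmf.expectation ?L ?K)"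
    using iA iK by simp
  also have "\<dots> = lam\<^sup>2 * ((1 - lam) * (3 * ?X + ?X ^ 3) + lam * measure_pmf.expectation ?L ?K)"
    unfolding A by simp
  also have "\<dots> \<le> lam\<^sup>2 * ((1 - lam) * (3 * ?X + ?X ^ 3) + lam * min (3 * cap quartic_kernel P) (4 / 3))"
    using quartic.cap_replicate[OF P, of 3] quartic.cap_bounds[of "\<lambda>s. replicate_pmf 3 (P s)"] lam
    unfolding K by (intro mult_left_mono add_left_mono) auto
  finally show ?thesis .
qed

lemma quartic_cap_ge: "cap chi_kernel P + (cap chi_kernel P)\<^sup>2 / 3 \<le> cap quartic_kernel P"
proof -
  let ?E = "measure_pmf.expectation (law P)"
  let ?X = "cap chi_kernel P"
  have X: "?X = ?E (\<lambda>x. x\<^sup>2)" by (simp add: chi.cap_law chi_kernel_one_pm)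
  have i: "integrable (measure_pmf (law P)) (\<lambda>x. x\<^sup>2)" "integrable (measure_pmf (law P)) (\<lambda>x. x ^ 4)"
  proof -
    have "x ^ 4 \<le> 1" if "\<bar>x\<bar> \<le> 1" for x :: real
      using power_le_one[of "\<bar>x\<bar>" 4] that by simp
    then show "integrable (measure_pmf (law P)) (\<lambda>x. x\<^sup>2)" "integrable (measure_pmf (law P)) (\<lambda>x. x ^ 4)"
      using law_abs[of _ P] by (auto intro!: integrable_pmf_bounded[where B=1] simp: abs_square_le_1)
  qed
  have "0 \<le> ?E (\<lambda>x. (x\<^sup>2 - ?X)\<^sup>2)" by (intro integral_nonneg_AE AE_pmfI) simp
  also have "(\<lambda>x. (x\<^sup>2 - ?X)\<^sup>2) = (\<lambda>x. x ^ 4 - 2 * ?X * x\<^sup>2 + ?X\<^sup>2)" by (rule ext) algebra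
  also have "?E \<dots> = ?E (\<lambda>x. x ^ 4) - 2 * ?X * ?X + ?X\<^sup>2" using i by (simp add: X)
  finally have "?X\<^sup>2 \<le> ?E (\<lambda>x. x ^ 4)" by (simp add: power2_eq_square)
  moreover have "cap quartic_kernel P = ?X + ?E (\<lambda>x. x ^ 4) / 3"
    using i by (simp add: quartic.cap_law quartic_kernel_one_pm X)
  ultimately show ?thesis by simp
qed

section \<open>Convergence to zero\<close>

lemma chi_cap_tendsto_zero_degenerate:
  assumes "0 \<le> lam" "lam \<le> 1" "integrable (measure_pmf D) real"
    and "lam = 0 \<or> measure_pmf.expectation D real = 0"
  shows "(\<lambda>k. cap chi_kernel (obs_pmf D r lam k)) \<longlonglongrightarrow> 0"
proof (rule tendsto_zero_of_Suc_nonpos)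
  have "gain 0 j = 0" for j by (simp add: gain_def)
  then have "bsum (gain 0) e n i = 0" for e n i by (induction n arbitrary: i) simp_all
  then show "cap chi_kernel (obs_pmf D r lam (Suc k)) \<le> 0" for k
    using chi_step[OF assms(1-3), of r k] assms(4) by auto
qed (rule chi_cap_bounds)

text \<open>The strict inequality for \<open>gain\<close> leaves a uniform quadratic margin over the
  finitely many \<open>j\<close>, so that \<open>?x (Suc k) \<le> ?x k - c * (?x k)\<^sup>2\<close>
  even at equality in \<open>KS\<close>.\<close>

lemma chi_cap_tendsto_zero_critical:
  fixes D :: "nat pmf"
  defines "d \<equiv> measure_pmf.expectation D real"
  assumes lam: "0 \<le> lam" "lam \<le> 1" and D: "integrable (measure_pmf D) real"
    and r: "r \<ge> 3" and KS: "(real r - 1) * d * lam\<^sup>2 \<le> 1"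
    and gain: "\<And>j. 0 < lam \<Longrightarrow> 2 \<le> j \<Longrightarrow> j \<le> r - 1 \<Longrightarrow> gain lam j < lam\<^sup>2 * real j"
  shows "(\<lambda>k. cap chi_kernel (obs_pmf D r lam k)) \<longlonglongrightarrow> 0"
proof (cases "lam = 0 \<or> d = 0")
  case True
  then show ?thesis using chi_cap_tendsto_zero_degenerate[OF lam D] by (simp add: d_def)
next
  case False
  define n where "n = r - 1"
  have n: "real r - 1 = real n" "n \<ge> 2" using r by (auto simp: n_def)
  have "0 \<le> d" unfolding d_def by (intro integral_nonneg_AE AE_pmfI) simp
  then have pos: "0 < d" "0 < lam" using False lam by auto
  let ?x = "\<lambda>k. cap chi_kernel (obs_pmf D r lam k)"
  \<comment> \<open>The largest margin valid for all \<open>j\<close> from 2 to \<open>n\<close>; at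
    \<open>j = 0\<close> and \<open>j = 1\<close> the bound on \<open>gain\<close> is an equality,
    as \<open>gain lam 1 = lam\<^sup>2\<close>.\<close>
  define \<delta> where "\<delta> = Min ((\<lambda>j. (lam\<^sup>2 * real j - gain lam j) / (real j * (real j - 1))) ` {2..n})"
  have \<delta>: "0 < \<delta>" unfolding \<delta>_def using n gain pos by (subst Min_gr_iff) (auto simp: n_def)
  have g: "gain lam j \<le> lam\<^sup>2 * real j - \<delta> * (real j * (real j - 1))" if "j \<le> 0 + n" for j
  proof -
    consider "j = 0" | "j = 1" | "2 \<le> j" by linarith
    then show ?thesis
    proof cases
      case 3
      then have "\<delta> \<le> (lam\<^sup>2 * real j - gain lam j) / (real j * (real j - 1))"
        unfolding \<delta>_def using that by (intro Min_le) auto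
      moreover have "0 < real j * (real j - 1)" using 3 by simp
      ultimately show ?thesis by (simp add: pos_le_divide_eq)
    qed (use pos in \<open>auto simp: gain_def\<close>)
  qed
  define c where "c = d * (\<delta> * (real n * (real n - 1)))"
  have c: "0 < c" using pos \<delta> n by (simp add: c_def)
  have step: "?x (Suc k) \<le> ?x k - c * (?x k)\<^sup>2" for k
  proof -
    have x: "0 \<le> ?x k" "?x k \<le> 1" by (rule chi_cap_bounds)+
    have "?x (Suc k) \<le> d * bsum (gain lam) (?x k) n 0"
      using chi_step[OF lam D] by (simp add: d_def n_def)
    also have "\<dots> \<le> d * (lam\<^sup>2 * (real n * ?x k) - \<delta> * (real n * (real n - 1) * (?x k)\<^sup>2))"
      using bsum_quadratic_bound[of "?x k" 0 n, OF x g] pos by (intro mult_left_mono) auto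
    also have "\<dots> = (real n * d * lam\<^sup>2) * ?x k - c * (?x k)\<^sup>2"
      unfolding c_def by algebra
    also have "\<dots> \<le> 1 * ?x k - c * (?x k)\<^sup>2"
      using KS n x by (intro diff_right_mono mult_right_mono) auto
    finally show ?thesis by simp
  qed
  show ?thesis
  proof (rule tendsto_zero_of_square_bound[OF c, of ?x])
    show "?x (Suc k) \<le> ?x k" for k
    proof -
      have "0 \<le> c * (?x k)\<^sup>2" using c by simp
      then show ?thesis using step[of k] by linarith
    qed
    show "\<forall>\<^sub>F k in sequentially. c * (?x k)\<^sup>2 \<le> ?x k - ?x (Suc k)"
      using step by (intro always_eventually allI) (simp add: algebra_simps)
  qed (rule chi_cap_bounds)+
qed

lemma gain_less:
  assumes "0 < lam" "1 < (lam + (1 - lam) * (2 / 2 ^ j)) * real j"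
  shows "gain lam j < lam\<^sup>2 * real j"
proof -
  let ?d = "lam + (1 - lam) * (2 / 2 ^ j)"
  have p: "2 powr (1 - real j) = 2 / 2 ^ j" by (simp add: powr_diff powr_realpow)
  have j: "0 < j" using assms(2) by (cases j) auto
  have d: "0 < ?d" using assms(2) j by (smt (verit) mult_nonpos_nonneg of_nat_0_le_iff)
  have "lam\<^sup>2 * 1 < lam\<^sup>2 * (?d * real j)" using assms by (intro mult_strict_left_mono) auto
  then have "lam\<^sup>2 / ?d < lam\<^sup>2 * real j" using d by (simp add: pos_divide_less_eq mult.commute mult.left_commute)
  then show ?thesis using j by (simp add: gain_def p)
qed

lemma gain_less_of_lam_ge:
  assumes "1 / 5 \<le> lam" "lam \<le> 1" "2 \<le> j"
  shows "gain lam j < lam\<^sup>2 * real j"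
proof (rule gain_less)
  \<comment> \<open>From \<open>j = 6\<close> on, \<open>lam * j \<ge> 6 / 5\<close> is enough; at
    \<open>j = 5\<close> this product can equal 1, so the values 2 to 5 also use the term with the
    power of two.\<close>
  have "j = 2 \<or> j = 3 \<or> j = 4 \<or> j = 5 \<or> 6 \<le> j" using assms(3) by auto
  then show "1 < (lam + (1 - lam) * (2 / 2 ^ j)) * real j"
  proof (elim disjE)
    assume j: "6 \<le> j"
    have "1 < 1 / 5 * (6 :: real)" by simp
    also have "\<dots> \<le> (lam + (1 - lam) * (2 / 2 ^ j)) * real j"
      using j assms by (intro mult_mono) (auto intro: add_increasing2)
    finally show ?thesis .
  qed (use assms in \<open>auto simp: field_simps\<close>)
qed (use assms in simp)

lemma chi_cap_tendsto_zero_sup: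
  fixes D :: "nat pmf"
  defines "d \<equiv> measure_pmf.expectation D real"
  assumes lam: "0 \<le> lam" "lam \<le> 1" and D: "integrable (measure_pmf D) real"
    and r: "r \<ge> 2" and sup: "(real r - 1) * d * (SUP eps\<in>{0<..1}. f_rl r lam eps) < 1"
  shows "(\<lambda>k. cap chi_kernel (obs_pmf D r lam k)) \<longlonglongrightarrow> 0"
proof -
  let ?x = "\<lambda>k. cap chi_kernel (obs_pmf D r lam k)"
  let ?S = "SUP eps\<in>{0<..1}. f_rl r lam eps"
  define q where "q = max 0 ((real r - 1) * d * ?S)"
  have q: "0 \<le> q" "q < 1" using sup by (auto simp: q_def)
  have d: "0 \<le> d" unfolding d_def by (intro integral_nonneg_AE AE_pmfI) simp
  \<comment> \<open>Compactness of \<open>{0..1}\<close> bounds the image, so that the supremum over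
    \<open>{0<..1}\<close> really is an upper bound.\<close>
  have "continuous_on {0..1} (f_rl r lam)"
    unfolding f_rl_def by (intro continuous_intros)
  then have "bdd_above (f_rl r lam ` {0..1})"
    by (intro bounded_imp_bdd_above compact_imp_bounded compact_continuous_image) auto
  then have bdd: "bdd_above (f_rl r lam ` {0<..1})"
    by (rule bdd_above_mono) auto
  have step: "?x (Suc k) \<le> q * ?x k" for k
  proof -
    have x: "0 \<le> ?x k" "?x k \<le> 1" by (rule chi_cap_bounds)+
    have 1: "?x (Suc k) \<le> d * (?x k * ((real r - 1) * f_rl r lam (?x k)))"
      using chi_step[OF lam D, of r k] by (simp only: d_def bsum_gain_f_rl[OF r])
    show ?thesis
    proof (cases "?x k = 0")
      case True
      then show ?thesis using 1 by simp
    next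
      case False
      then have "f_rl r lam (?x k) \<le> ?S" using x by (intro cSUP_upper bdd) auto
      then have "((real r - 1) * d) * f_rl r lam (?x k) \<le> ((real r - 1) * d) * ?S"
        using r d by (intro mult_left_mono) auto
      also have "\<dots> \<le> q" by (simp add: q_def)
      finally have "((real r - 1) * d) * f_rl r lam (?x k) * ?x k \<le> q * ?x k"
        using x by (intro mult_right_mono)
      then show ?thesis using 1 by (simp add: ac_simps)
    qed
  qed
  have "?x k \<le> q ^ k" for k
  proof (induction k)
    case 0
    show ?case using chi_cap_bounds(2) by simp
  next
    case (Suc k)
    have "?x (Suc k) \<le> q * ?x k" by (rule step)
    also have "\<dots> \<le> q * q ^ k" using Suc q by (intro mult_left_mono)
    finally show ?case by (simp only: power_Suc)
  qed
  then show ?thesis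
    by (intro tendsto_sandwich[OF _ _ tendsto_const LIMSEQ_realpow_zero[OF q]])
       (auto intro!: always_eventually chi_cap_bounds)
qed

text \<open>The quartic capacity \<open>?s\<close> is the Lyapunov sequence. First the bounded term
  of the chord drives \<open>?s\<close> below 1/2; there the cubic term is small enough for the
  excess of \<open>?s\<close> over \<open>?x\<close> to give a decrease of order
  \<open>(?x k)\<^sup>2\<close>.\<close>

lemma chi_cap_tendsto_zero_quartic:
  fixes D :: "nat pmf"
  defines "d \<equiv> measure_pmf.expectation D real"
  assumes lam: "0 < lam" "lam < 1" and D: "integrable (measure_pmf D) real"
    and KS: "3 * d * lam\<^sup>2 \<le> 1"
  shows "(\<lambda>k. cap chi_kernel (obs_pmf D 4 lam k)) \<longlonglongrightarrow> 0"
proof -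
  let ?x = "\<lambda>k. cap chi_kernel (obs_pmf D 4 lam k)" and ?s = "\<lambda>k. cap quartic_kernel (obs_pmf D 4 lam k)"
  have lam': "0 \<le> lam" "lam \<le> 1" using lam by auto
  have d: "0 \<le> d" unfolding d_def by (intro integral_nonneg_AE AE_pmfI) simp
  have x: "0 \<le> ?x k" "?x k \<le> 1" for k by (rule chi_cap_bounds)+
  have s: "0 \<le> ?s k" for k using quartic.cap_bounds by blast
  have xs: "?x k + (?x k)\<^sup>2 / 3 \<le> ?s k" for k by (rule quartic_cap_ge)
  have step: "?s (Suc k) \<le> (1 - lam) * (?x k + (?x k) ^ 3 / 3) + lam * min (?s k) (4 / 9)" for k
  proof -
    let ?R = "(1 - lam) * (3 * ?x k + (?x k) ^ 3) + lam * min (3 * ?s k) (4 / 3)"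
    have "?s (Suc k) \<le> d * cap quartic_kernel (hyperedge lam 3 (obs_pmf D 4 lam k))"
      using quartic.cap_obs_Suc[OF lam' D, of 4 k] by (simp add: d_def)
    also have "\<dots> \<le> d * (lam\<^sup>2 * ?R)"
      using d by (intro mult_left_mono quartic_cap_hyperedge obs_pmf_symmetric lam lam') auto
    also have "\<dots> = (3 * d * lam\<^sup>2) * (?R / 3)" by simp
    also have "\<dots> \<le> 1 * (?R / 3)"
      using KS lam x[of k] s[of k] by (intro mult_right_mono) auto
    also have "\<dots> = (1 - lam) * (?x k + (?x k) ^ 3 / 3) + lam * (min (3 * ?s k) (4 / 3) / 3)"
      by (simp add: field_simps)
    also have "min (3 * ?s k) (4 / 3) / 3 = min (?s k) (4 / 9)" by (simp add: min_def)
    finally show ?thesis .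
  qed
  have cube: "(?x k) ^ 3 \<le> (?x k)\<^sup>2" for k using x[of k] by (intro power_decreasing) auto
  have xs': "?x k + (?x k) ^ 3 / 3 \<le> ?s k" for k using xs[of k] cube[of k] by linarith
  have step': "?s (Suc k) \<le> (1 - lam) * ?s k + lam * min (?s k) (4 / 9)" for k
    using step[of k] mult_left_mono[OF xs'[of k], of "1 - lam"] lam by linarith
  have dec: "?s (Suc k) \<le> ?s k" for k
  proof -
    have "lam * min (?s k) (4 / 9) \<le> lam * ?s k" using lam by (intro mult_left_mono) auto
    then show ?thesis using step'[of k] by (simp add: algebra_simps)
  qed
  then have "decseq ?s" by (rule decseq_SucI)
  then obtain L where L: "?s \<longlonglongrightarrow> L" using decseq_convergent[of ?s 0] s by blast
  \<comment> \<open>Passing to the limit in \<open>step'\<close>; the constant 4/9 is a third of the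
    universal bound 4/3.\<close>
  have "L \<le> (1 - lam) * L + lam * (4 / 9)"
  proof (rule LIMSEQ_le[OF LIMSEQ_Suc[OF L]])
    show "(\<lambda>k. (1 - lam) * ?s k + lam * (4 / 9)) \<longlonglongrightarrow> (1 - lam) * L + lam * (4 / 9)"
      by (intro tendsto_intros L)
    have "lam * min (?s k) (4 / 9) \<le> lam * (4 / 9)" for k using lam by (intro mult_left_mono) auto
    then show "\<exists>N. \<forall>k\<ge>N. ?s (Suc k) \<le> (1 - lam) * ?s k + lam * (4 / 9)"
      using step' by (meson add_left_mono order_trans)
  qed
  then have "lam * L \<le> lam * (4 / 9)" by (simp add: algebra_simps)
  then have "L < 1 / 2" using lam by simp
  with L have ev: "\<forall>\<^sub>F k in sequentially. ?s k < 1 / 2" by (rule order_tendstoD)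
  show ?thesis
  proof (rule tendsto_zero_of_square_bound[where c = "(1 - lam) / 6" and s = ?s])
    show "\<forall>\<^sub>F k in sequentially. (1 - lam) / 6 * (?x k)\<^sup>2 \<le> ?s k - ?s (Suc k)"
      using ev
    proof eventually_elim
      case (elim k)
      \<comment> \<open>With \<open>?x k \<le> 1 / 2\<close> the cubic term is at most
        \<open>(?x k)\<^sup>2 / 6\<close>, half of the surplus \<open>(?x k)\<^sup>2 / 3\<close>
        provided by \<open>quartic_cap_ge\<close>.\<close>
      have "0 \<le> (?x k)\<^sup>2 / 3" by simp
      then have "?x k \<le> 1 / 2" using elim xs[of k] by linarith
      then have "(?x k)\<^sup>2 * ?x k \<le> (?x k)\<^sup>2 * (1 / 2)" by (intro mult_left_mono) auto
      then have "(?x k) ^ 3 \<le> (?x k)\<^sup>2 / 2" by (simp add: power2_eq_square power3_eq_cube)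
      then have "?x k + (?x k) ^ 3 / 3 \<le> ?s k - (?x k)\<^sup>2 / 6" using xs[of k] by linarith
      then have "(1 - lam) * (?x k + (?x k) ^ 3 / 3) \<le> (1 - lam) * (?s k - (?x k)\<^sup>2 / 6)"
        using lam by (intro mult_left_mono) auto
      moreover have "lam * min (?s k) (4 / 9) \<le> lam * ?s k" using lam by (intro mult_left_mono) auto
      ultimately have "?s (Suc k) \<le> (1 - lam) * (?s k - (?x k)\<^sup>2 / 6) + lam * ?s k"
        using step[of k] by linarith
      then show ?case by (simp add: algebra_simps)
    qed
  qed (use lam s dec x in auto)
qed

section \<open>Assembly of the three parts from the convergence criteria\<close>

theorem theorem2:
  fixes D :: "nat pmf" and r :: nat and lam d :: real
  assumes "0 \<le> lam" and "lam \<le> 1"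
    and "integrable (measure_pmf D) real"
    and "d = measure_pmf.expectation D real"
  shows "(r \<in> {3, 4} \<and> (real r - 1) * d * lam\<^sup>2 \<le> 1 \<longrightarrow> reconstruction_impossible D r lam)
     \<and> (r \<ge> 5 \<and> (real r - 1) * d * (SUP eps\<in>{0<..1}. f_rl r lam eps) < 1 \<longrightarrow> reconstruction_impossible D r lam)
     \<and> (r \<ge> 5 \<and> lam \<ge> 1/5 \<and> (real r - 1) * d * lam\<^sup>2 \<le> 1 \<longrightarrow> reconstruction_impossible D r lam)"
proof (intro conjI impI; elim conjE; rule reconstruction_impossibleI)
  note D = assms(1-3)
  show "(\<lambda>k. cap chi_kernel (obs_pmf D r lam k)) \<longlonglongrightarrow> 0"
    if "r \<ge> 5" "(real r - 1) * d * (SUP eps\<in>{0<..1}. f_rl r lam eps) < 1"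
    using that assms(4) by (intro chi_cap_tendsto_zero_sup[OF D]) auto
  have large: "(\<lambda>k. cap chi_kernel (obs_pmf D r lam k)) \<longlonglongrightarrow> 0"
    if "r \<ge> 3" "lam \<ge> 1/5" "(real r - 1) * d * lam\<^sup>2 \<le> 1"
    using that assms(2,4) by (intro chi_cap_tendsto_zero_critical[OF D] gain_less_of_lam_ge) auto
  then show "(\<lambda>k. cap chi_kernel (obs_pmf D r lam k)) \<longlonglongrightarrow> 0"
    if "r \<ge> 5" "lam \<ge> 1/5" "(real r - 1) * d * lam\<^sup>2 \<le> 1" using that by simp
  show "(\<lambda>k. cap chi_kernel (obs_pmf D r lam k)) \<longlonglongrightarrow> 0"
    if r: "r \<in> {3, 4}" and KS: "(real r - 1) * d * lam\<^sup>2 \<le> 1"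
  proof -
    \<comment> \<open>For \<open>r = 4\<close> the strict inequality for \<open>gain\<close> at
      \<open>j = 3\<close> amounts to \<open>lam > 1 / 9\<close>, so small \<open>lam\<close> needs
      the quartic kernel; the cut at 1/5 lets \<open>large\<close> cover the rest.\<close>
    consider "r = 3" | "r = 4" "lam = 0" | "r = 4" "0 < lam" "lam < 1/5" | "r = 4" "lam \<ge> 1/5"
      using r assms(1) by fastforce
    then show ?thesis
    proof cases
      case 1
      have "gain lam j < lam\<^sup>2 * real j" if "0 < lam" "2 \<le> j" "j \<le> r - 1" for j
      proof -
        \<comment> \<open>At \<open>j = 2\<close> the condition of \<open>gain_less\<close> reads
          \<open>1 < 1 + lam\<close>.\<close>
        have "j = 2" using that 1 by simp
        then show ?thesis using that by (intro gain_less) (auto simp: field_simps)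
      qed
      then show ?thesis using 1 KS assms(4) by (intro chi_cap_tendsto_zero_critical[OF D]) auto
    next
      case 2
      then show ?thesis using chi_cap_tendsto_zero_degenerate[OF D] by simp
    next
      case 3
      then show ?thesis using KS assms(3,4) chi_cap_tendsto_zero_quartic[of lam D] by simp
    next
      case 4
      then show ?thesis using KS by (intro large) auto
    qed
  qed
qed

end
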